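(* Let $G$ be a non-abelian group of order $2^5$. Then $\mathrm{Aut}_c(G)=\mathrm{Aut}_z(G)$ if and only if $G$ belongs to the isoclinism family $\Phi_5$.
   Context: $\mathrm{Aut}_c(G)$ is the group of all class preserving automorphisms of $G$, i.e. automorphisms $\alpha$ such that $\alpha(x)$ is conjugate to $x$ in $G$ for every $x\in G$. $\mathrm{Aut}_z(G)$ is the group of all central automorphisms of $G$, i.e. automorphisms $\phi$ such that $g^{-1}\phi(g)\in Z(G)$ for every $g\in G$. Commutators are $[a,b]=a^{-1}b^{-1}ab$ and $\gamma_2(G)$ is the commutator subgroup. Two groups $G,H$ are isoclinic if there are isomorphisms $\theta:G/Z(G)\to H/Z(H)$ and $\varphi:\gamma_2(G)\to\gamma_2(H)$ such that $\varphi([a,b])=[a',b']$ whenever $a'Z(H)=\theta(aZ(G))$ and $b'Z(H)=\theta(bZ(G))$. $\Phi_5$ (the fifth isoclinism family of groups of order 32 in the Hall–Senior list) consists of all groups of order 32 isoclinic to the (extraspecial) group $$G_{43}=\langle x,y,z,w \mid w^2=1,\ x^2=y^2=z^2,\ [z,y]x^2=1,\ [w,x]x^2=1,\ [x,y]=[x,z]=[y,w]=[z,w]=1\rangle .$$ *)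

theory Defs
  imports "HOL-Algebra.Algebra"
begin

section \<open>Centre, commutators, and two groups of automorphisms\<close>

definition group_center :: "('a, 'b) monoid_scheme \<Rightarrow> 'a set" where
  "group_center G = {z \<in> carrier G. \<forall>g \<in> carrier G. z \<otimes>\<^bsub>G\<^esub> g = g \<otimes>\<^bsub>G\<^esub> z}"

definition commutator :: "('a, 'b) monoid_scheme \<Rightarrow> 'a \<Rightarrow> 'a \<Rightarrow> 'a" where
  "commutator G a b = inv\<^bsub>G\<^esub> a \<otimes>\<^bsub>G\<^esub> inv\<^bsub>G\<^esub> b \<otimes>\<^bsub>G\<^esub> a \<otimes>\<^bsub>G\<^esub> b"

text \<open>Elements of \<^term>\<open>auto G\<close> are extensional functions, so equality of
  the sets below is equality of sets of automorphisms.\<close>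

definition Aut_c :: "('a, 'b) monoid_scheme \<Rightarrow> ('a \<Rightarrow> 'a) set" where
  "Aut_c G = {\<alpha> \<in> auto G. \<forall>x \<in> carrier G. \<exists>g \<in> carrier G. \<alpha> x = inv\<^bsub>G\<^esub> g \<otimes>\<^bsub>G\<^esub> x \<otimes>\<^bsub>G\<^esub> g}"

definition Aut_z :: "('a, 'b) monoid_scheme \<Rightarrow> ('a \<Rightarrow> 'a) set" where
  "Aut_z G = {\<phi> \<in> auto G. \<forall>g \<in> carrier G. inv\<^bsub>G\<^esub> g \<otimes>\<^bsub>G\<^esub> \<phi> g \<in> group_center G}"


section \<open>Isoclinism\<close>

text \<open>The library's \<^term>\<open>derived G (carrier G)\<close> is generated by the elements
  \<open>a b a\<inverse> b\<inverse>\<close>; these are the commutators above of \<open>a\<inverse>\<close> and \<open>b\<inverse>\<close>, so the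
  choice of convention does not matter.\<close>

lemma (in group) derived_eq_generate_commutators:
  "derived G (carrier G) = generate G {commutator G a b | a b. a \<in> carrier G \<and> b \<in> carrier G}"
proof -
  have "derived_set G (carrier G) = {commutator G a b | a b. a \<in> carrier G \<and> b \<in> carrier G}"
    (is "?D = ?C")
  proof (intro equalityI subsetI)
    fix x assume "x \<in> ?D"
    then obtain a b where ab: "a \<in> carrier G" "b \<in> carrier G"
      and x: "x = a \<otimes> b \<otimes> inv a \<otimes> inv b"
      by (elim UN_E singletonE)
    have "x = commutator G (inv a) (inv b)"
      unfolding x commutator_def using ab by simp
    with ab show "x \<in> ?C" by (intro CollectI exI[of _ "inv a"] exI[of _ "inv b"]) simp
  next
    fix x assume "x \<in> ?C"
    then obtain a b where ab: "a \<in> carrier G" "b \<in> carrier G" and x: "x = commutator G a b"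
      by (elim CollectE exE conjE)
    have "x = inv a \<otimes> inv b \<otimes> inv (inv a) \<otimes> inv (inv b)"
      unfolding x commutator_def using ab by simp
    with ab show "x \<in> ?D" by (intro UN_I[of "inv a"] UN_I[of "inv b"]) simp_all
  qed
  then show ?thesis by (simp only: derived_def)
qed

text \<open>The elements of \<^term>\<open>G Mod N\<close> are right cosets, which for the central
  subgroup here are also the left cosets.\<close>

definition isoclinic :: "('a, 'b) monoid_scheme \<Rightarrow> ('c, 'd) monoid_scheme \<Rightarrow> bool" where
  "isoclinic G H \<longleftrightarrow>
    (\<exists>\<theta> \<phi>.
      \<theta> \<in> iso (G Mod group_center G) (H Mod group_center H) \<and>
      \<phi> \<in> iso (G\<lparr>carrier := derived G (carrier G)\<rparr>) (H\<lparr>carrier := derived H (carrier H)\<rparr>) \<and>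
      (\<forall>a \<in> carrier G. \<forall>b \<in> carrier G. \<forall>a' \<in> carrier H. \<forall>b' \<in> carrier H.
        group_center H #>\<^bsub>H\<^esub> a' = \<theta> (group_center G #>\<^bsub>G\<^esub> a) \<longrightarrow>
        group_center H #>\<^bsub>H\<^esub> b' = \<theta> (group_center G #>\<^bsub>G\<^esub> b) \<longrightarrow>
        \<phi> (commutator G a b) = commutator H a' b'))"


section \<open>Groups given by generators and relations\<close>

text \<open>A word is a list of letters \<open>(g, True)\<close>, standing for \<open>g\<close>, and
  \<open>(g, False)\<close>, standing for \<open>g\<inverse>\<close>. A relation \<open>u = v\<close> is a pair of words.
  The presented group is the set of words modulo the congruence generated by
  free cancellation and the relations; all of the type \<open>'g\<close> serves as the
  set of generators.\<close>

type_synonym 'g word = "('g \<times> bool) list"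

definition word_inv :: "'g word \<Rightarrow> 'g word" where
  "word_inv w = rev (map (\<lambda>(g, e). (g, \<not> e)) w)"

definition word_comm :: "'g word \<Rightarrow> 'g word \<Rightarrow> 'g word" where
  "word_comm u v = word_inv u @ word_inv v @ u @ v"

inductive_set word_cong :: "('g word \<times> 'g word) set \<Rightarrow> ('g word \<times> 'g word) set"
  for R :: "('g word \<times> 'g word) set" where
  cancel: "([(g, e), (g, \<not> e)], []) \<in> word_cong R"
| rel: "(u, v) \<in> R \<Longrightarrow> (u, v) \<in> word_cong R"
| refl: "(u, u) \<in> word_cong R"
| sym: "(u, v) \<in> word_cong R \<Longrightarrow> (v, u) \<in> word_cong R"
| trans: "(u, v) \<in> word_cong R \<Longrightarrow> (v, w) \<in> word_cong R \<Longrightarrow> (u, w) \<in> word_cong R"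
| append: "(u, u') \<in> word_cong R \<Longrightarrow> (v, v') \<in> word_cong R \<Longrightarrow> (u @ v, u' @ v') \<in> word_cong R"

definition presented_group :: "('g word \<times> 'g word) set \<Rightarrow> 'g word set monoid" where
  "presented_group R =
    \<lparr>carrier = UNIV // word_cong R,
     monoid.mult = (\<lambda>A B. \<Union>u \<in> A. \<Union>v \<in> B. word_cong R `` {u @ v}),
     one = word_cong R `` {[]}\<rparr>"

lemma equiv_word_cong: "equiv UNIV (word_cong R)"
proof (rule equivI)
  show "word_cong R \<subseteq> UNIV \<times> UNIV" by simp
  show "refl_on UNIV (word_cong R)" by (intro refl_onI word_cong.refl)
  show "sym (word_cong R)" by (rule symI) (rule word_cong.sym)
  show "trans (word_cong R)" by (rule transI) (rule word_cong.trans)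
qed

lemma word_class_eq_iff: "word_cong R `` {u} = word_cong R `` {v} \<longleftrightarrow> (u, v) \<in> word_cong R"
  by (rule eq_equiv_class_iff[OF equiv_word_cong]) auto

lemma carrier_presented_group: "carrier (presented_group R) = range (\<lambda>u. word_cong R `` {u})"
  by (auto simp: presented_group_def quotient_def)

lemma one_presented_group: "\<one>\<^bsub>presented_group R\<^esub> = word_cong R `` {[]}"
  by (simp add: presented_group_def)

lemma mult_presented_group:
  "(word_cong R `` {u}) \<otimes>\<^bsub>presented_group R\<^esub> (word_cong R `` {v}) = word_cong R `` {u @ v}"
proof -
  have "word_cong R `` {u' @ v'} = word_cong R `` {u @ v}"
    if "u' \<in> word_cong R `` {u}" "v' \<in> word_cong R `` {v}" for u' v'
    unfolding word_class_eq_iff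
    by (rule word_cong.sym[OF word_cong.append]) (use that in simp_all)
  moreover have "u \<in> word_cong R `` {u}" "v \<in> word_cong R `` {v}"
    by (auto intro: word_cong.refl)
  ultimately show ?thesis
    unfolding presented_group_def monoid.simps by blast
qed

lemma word_inv_cong: "(word_inv w @ w, []) \<in> word_cong R"
proof (induction w)
  case Nil
  show ?case by (simp add: word_inv_def word_cong.refl)
next
  case (Cons a w)
  obtain g e where a: "a = (g, e)" by (cases a)
  have "([(g, \<not> e), (g, e)], []) \<in> word_cong R"
    using word_cong.cancel[of g "\<not> e" R] by simp
  then have "(word_inv w @ [(g, \<not> e), (g, e)] @ w, word_inv w @ [] @ w) \<in> word_cong R"
    by (intro word_cong.append word_cong.refl)
  then have "(word_inv (a # w) @ a # w, word_inv w @ w) \<in> word_cong R"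
    by (simp add: a word_inv_def)
  from this Cons.IH show ?case by (rule word_cong.trans)
qed

lemma group_presented_group: "group (presented_group R)"
proof (rule groupI)
  fix x assume "x \<in> carrier (presented_group R)"
  then obtain u where u: "x = word_cong R `` {u}" by (auto simp: carrier_presented_group)
  show "\<exists>y \<in> carrier (presented_group R). y \<otimes>\<^bsub>presented_group R\<^esub> x = \<one>\<^bsub>presented_group R\<^esub>"
    by (rule bexI[of _ "word_cong R `` {word_inv u}"])
      (auto simp: u carrier_presented_group mult_presented_group one_presented_group
        word_class_eq_iff word_inv_cong)
next
  fix x y z
  assume "x \<in> carrier (presented_group R)" "y \<in> carrier (presented_group R)"
    "z \<in> carrier (presented_group R)"
  then show "x \<otimes>\<^bsub>presented_group R\<^esub> y \<otimes>\<^bsub>presented_group R\<^esub> z =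
      x \<otimes>\<^bsub>presented_group R\<^esub> (y \<otimes>\<^bsub>presented_group R\<^esub> z)"
    by (auto simp only: carrier_presented_group mult_presented_group append_assoc)
qed (auto simp only: carrier_presented_group mult_presented_group one_presented_group append_Nil)


section \<open>The isoclinism family of the extraspecial group\<close>

datatype gen = gen_x | gen_y | gen_z | gen_w

definition G43 :: "gen word set monoid" where
  "G43 =
    (let x = [(gen_x, True)]; y = [(gen_y, True)]; z = [(gen_z, True)]; w = [(gen_w, True)]
     in presented_group
      {(w @ w, []),
       (x @ x, y @ y),
       (y @ y, z @ z),
       (word_comm z y @ x @ x, []),
       (word_comm w x @ x @ x, []),
       (word_comm x y, []),
       (word_comm x z, []),
       (word_comm y w, []),
       (word_comm z w, [])})"

definition Phi5 :: "('a, 'b) monoid_scheme set" where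
  "Phi5 = {G. group G \<and> order G = 2 ^ 5 \<and> isoclinic G G43}"

end

theory Submission
  imports Defs
begin

text \<open>A non-abelian \<open>G\<close> of order 32 turns out to satisfy either side exactly if
  \<open>|Z(G)| = 2\<close> and all commutators are central.

  If all commutators lie in a central subgroup \<open>{1, t}\<close>, then noncommutation is an alternating
  bilinear form on \<open>G/Z(G)\<close>. A symplectic basis of four elements determines \<open>G/Z(G)\<close>, the
  commutator subgroup and the commutator map, so any two such groups are isoclinic; \<open>G43\<close>
  is one of them, where \<open>t = x\<^sup>2 \<noteq> 1\<close> is seen from an action on 16 points.

  Suppose that the class preserving automorphisms are the central ones. Inner automorphisms are
  central, so \<open>G\<close> has class at most two, and counting cosets of centralizers shows that squares are
  central. Two kinds of central automorphisms then have to be class preserving. Multiplication by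
  a central involution \<open>u\<close> off a subgroup of index two containing \<open>Z(G)\<close> yields
  \<open>u \<in> [g, G]\<close> for all noncentral \<open>g\<close>; this is impossible for all \<open>g\<close> at once if there are two such
  involutions. The map \<open>g \<mapsto> g\<^sup>5\<close> yields \<open>z\<^sup>4 = 1\<close> on the centre, so \<open>|Z(G)| \<le> 4\<close>,
  and the existence of a symplectic basis does the rest.\<close>

section \<open>Commutators, centre and centralizers\<close>

context group
begin

lemma commutator_closed [simp]:
  assumes "a \<in> carrier G" "b \<in> carrier G"
  shows "commutator G a b \<in> carrier G"
  using assms by (simp add: commutator_def)

lemma mult_commutator:
  assumes "a \<in> carrier G" "b \<in> carrier G"
  shows "a \<otimes> b = b \<otimes> a \<otimes> commutator G a b"
proof -
  have "b \<otimes> a \<otimes> (inv a \<otimes> inv b \<otimes> a \<otimes> b) = b \<otimes> (a \<otimes> inv a) \<otimes> inv b \<otimes> a \<otimes> b"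
    using assms by (simp only: m_assoc m_closed inv_closed)
  then show ?thesis
    using assms by (simp add: commutator_def)
qed

lemma commutator_unique:
  assumes "a \<in> carrier G" "b \<in> carrier G" "c \<in> carrier G" "a \<otimes> b = b \<otimes> a \<otimes> c"
  shows "commutator G a b = c"
  using assms mult_commutator[of a b] l_cancel[of "b \<otimes> a" "commutator G a b" c] by simp

lemma commutator_eq_one_iff:
  assumes "a \<in> carrier G" "b \<in> carrier G"
  shows "commutator G a b = \<one> \<longleftrightarrow> a \<otimes> b = b \<otimes> a"
  using assms mult_commutator[of a b] commutator_unique[of a b \<one>] by auto

lemma conj_eq_mult_commutator:
  assumes "a \<in> carrier G" "b \<in> carrier G"
  shows "inv b \<otimes> a \<otimes> b = a \<otimes> commutator G a b"
  using assms by (simp add: commutator_def m_assoc[symmetric])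

lemma center_in_carrier: "z \<in> group_center G \<Longrightarrow> z \<in> carrier G"
  by (simp add: group_center_def)

lemma center_commute: "z \<in> group_center G \<Longrightarrow> g \<in> carrier G \<Longrightarrow> z \<otimes> g = g \<otimes> z"
  by (simp add: group_center_def)

lemma mult_commute_mult:
  assumes "g \<in> carrier G" "h \<in> carrier G" "a \<in> carrier G" "g \<otimes> a = a \<otimes> g" "h \<otimes> a = a \<otimes> h"
  shows "(g \<otimes> h) \<otimes> a = a \<otimes> (g \<otimes> h)"
proof -
  have "(g \<otimes> h) \<otimes> a = (g \<otimes> a) \<otimes> h" using assms(1-3) by (simp add: m_assoc assms(5))
  then show ?thesis using assms(1-3) by (simp add: assms(4) m_assoc)
qed

lemma inv_commute:
  assumes "g \<in> carrier G" "a \<in> carrier G" "g \<otimes> a = a \<otimes> g"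
  shows "inv g \<otimes> a = a \<otimes> inv g"
proof -
  have "g \<otimes> (a \<otimes> inv g) = (g \<otimes> a) \<otimes> inv g"
    using assms(1,2) by (simp add: m_assoc)
  also have "\<dots> = a"
    using assms by (simp add: m_assoc)
  also have "\<dots> = g \<otimes> (inv g \<otimes> a)"
    using assms(1,2) by (simp add: m_assoc[symmetric])
  finally show ?thesis
    using assms(1,2) by simp
qed

lemma centralizer_subgroup:
  assumes "a \<in> carrier G"
  shows "subgroup {g \<in> carrier G. g \<otimes> a = a \<otimes> g} G"
  by (rule subgroupI) (use assms in \<open>auto simp: mult_commute_mult inv_commute intro!: exI[of _ "\<one>"]\<close>)

lemma center_subgroup: "subgroup (group_center G) G"
proof -
  \<comment> \<open>The centre is the intersection of the centralizers; adding the carrier makes the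
    family visibly nonempty.\<close>
  have "group_center G = \<Inter> (insert (carrier G) ((\<lambda>a. {g \<in> carrier G. g \<otimes> a = a \<otimes> g}) ` carrier G))"
    unfolding group_center_def by blast
  also have "subgroup \<dots> G"
    by (rule subgroups_Inter) (auto simp: centralizer_subgroup subgroup_self)
  finally show ?thesis .
qed

lemma center_normal: "group_center G \<lhd> G"
  unfolding normal_inv_iff
proof (intro conjI ballI)
  fix x h assume "x \<in> carrier G" "h \<in> group_center G"
  moreover from this have "x \<otimes> h \<otimes> inv x = h"
    by (simp add: center_commute[symmetric] center_in_carrier m_assoc)
  ultimately show "x \<otimes> h \<otimes> inv x \<in> group_center G" by simp
qed (rule center_subgroup)

end

section \<open>Groups whose commutators take two values\<close>

text \<open>Noncommutation is a bilinear alternating form with values in \<^typ>\<open>bool\<close>,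
  addition being exclusive or, that is, \<open>\<noteq>\<close>.\<close>

locale two_commutator_group = group +
  fixes t
  assumes t_center: "t \<in> group_center G"
    and t_square: "t \<otimes> t = \<one>"
    and t_nontrivial: "t \<noteq> \<one>"
    and mult_swap: "\<lbrakk>g \<in> carrier G; h \<in> carrier G\<rbrakk> \<Longrightarrow> g \<otimes> h = h \<otimes> g \<or> g \<otimes> h = h \<otimes> g \<otimes> t"
begin

definition nc where "nc g h \<longleftrightarrow> g \<otimes> h \<noteq> h \<otimes> g"

lemma t_closed [simp]: "t \<in> carrier G"
  using t_center center_in_carrier by simp

lemma t_commute: "g \<in> carrier G \<Longrightarrow> t \<otimes> g = g \<otimes> t"
  using t_center center_commute by simp

lemma nc_self [simp]: "\<not> nc g g"
  by (simp add: nc_def)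

lemma nc_sym: "nc g h \<longleftrightarrow> nc h g"
  by (auto simp: nc_def)

lemma nc_one [simp]: "g \<in> carrier G \<Longrightarrow> \<not> nc \<one> g" "g \<in> carrier G \<Longrightarrow> \<not> nc g \<one>"
  by (auto simp: nc_def)

lemma nc_center: "z \<in> group_center G \<Longrightarrow> g \<in> carrier G \<Longrightarrow> \<not> nc z g"
  by (simp add: nc_def center_commute)

lemma center_iff: "z \<in> group_center G \<longleftrightarrow> z \<in> carrier G \<and> (\<forall>g \<in> carrier G. \<not> nc z g)"
  unfolding nc_def group_center_def by blast

lemma mult_nc:
  assumes "g \<in> carrier G" "h \<in> carrier G"
  shows "g \<otimes> h = h \<otimes> g \<otimes> (if nc g h then t else \<one>)"
  using assms mult_swap[of g h] by (auto simp: nc_def)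

lemma commutator_nc:
  assumes "g \<in> carrier G" "h \<in> carrier G"
  shows "commutator G g h = (if nc g h then t else \<one>)"
  by (rule commutator_unique[OF assms _ mult_nc[OF assms]]) simp

text \<open>Additivity of the form: moving \<open>g\<close> past \<open>b\<close> and then past
  \<open>a\<close> collects one central factor each, and two factors \<open>t\<close>
  cancel.\<close>

lemma nc_mult_left:
  assumes "a \<in> carrier G" "b \<in> carrier G" "g \<in> carrier G"
  shows "nc (a \<otimes> b) g \<longleftrightarrow> nc a g \<noteq> nc b g"
proof -
  define s where "s x = (if nc x g then t else \<one>)" for x
  have s: "s x \<in> carrier G" "y \<in> carrier G \<Longrightarrow> s x \<otimes> y = y \<otimes> s x" for x y
    by (auto simp: s_def t_commute)
  have "a \<otimes> b \<otimes> g = a \<otimes> (g \<otimes> b \<otimes> s b)"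
    using assms mult_nc[of b g] by (simp add: m_assoc s_def)
  also have "\<dots> = (a \<otimes> g) \<otimes> b \<otimes> s b"
    using assms s(1) by (simp add: m_assoc)
  also have "\<dots> = (g \<otimes> a \<otimes> s a) \<otimes> b \<otimes> s b"
    using assms mult_nc[of a g] by (simp add: s_def)
  also have "\<dots> = g \<otimes> a \<otimes> (s a \<otimes> b) \<otimes> s b"
    using assms s(1) by (simp add: m_assoc)
  also have "\<dots> = g \<otimes> (a \<otimes> b) \<otimes> (s a \<otimes> s b)"
    using assms s(1) by (simp add: s(2)[of b a] m_assoc)
  finally have "a \<otimes> b \<otimes> g = g \<otimes> (a \<otimes> b) \<otimes> (s a \<otimes> s b)" .
  then have "nc (a \<otimes> b) g \<longleftrightarrow> s a \<otimes> s b \<noteq> \<one>"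
    using assms s(1) by (simp add: nc_def)
  then show ?thesis
    by (simp add: s_def t_square t_nontrivial)
qed

lemma nc_inv:
  assumes "a \<in> carrier G" "g \<in> carrier G"
  shows "nc (inv a) g \<longleftrightarrow> nc a g"
  using nc_mult_left[of "inv a" a g] assms by simp

text \<open>A single noncommuting pair makes \<open>t\<close> a commutator, and \<one> and
  \<open>t\<close> already form a subgroup.\<close>

lemma derived_eq:
  assumes "a \<in> carrier G" "b \<in> carrier G" "nc a b"
  shows "derived G (carrier G) = {\<one>, t}"
proof -
  have "{commutator G a b |a b. a \<in> carrier G \<and> b \<in> carrier G} = {\<one>, t}" (is "?C = _")
  proof
    show "?C \<subseteq> {\<one>, t}" by (auto simp: commutator_nc)
    have "t = commutator G a b" "\<one> = commutator G a a"
      using assms by (auto simp: commutator_nc)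
    with assms show "{\<one>, t} \<subseteq> ?C" by auto
  qed
  moreover have "subgroup {\<one>, t} G"
    by (rule subgroupI) (auto simp: t_square inv_equality[of t t])
  ultimately show ?thesis
    unfolding derived_eq_generate_commutators
    by (metis generateI subset_refl)
qed

end

section \<open>Symplectic bases and isoclinism\<close>

text \<open>The additive group of a four-dimensional space over the field of two elements, written
  with booleans so that the truth values of \<open>nc\<close> serve directly as coordinates.\<close>

definition xor_group :: "(bool \<times> bool \<times> bool \<times> bool) monoid" where
  "xor_group =
    \<lparr>carrier = UNIV,
     monoid.mult = (\<lambda>(p, q, r, s) (p', q', r', s'). (p \<noteq> p', q \<noteq> q', r \<noteq> r', s \<noteq> s')),
     one = (False, False, False, False)\<rparr>"

lemma xor_group_simps:
  "carrier xor_group = UNIV"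
  "(p, q, r, s) \<otimes>\<^bsub>xor_group\<^esub> (p', q', r', s') = (p \<noteq> p', q \<noteq> q', r \<noteq> r', s \<noteq> s')"
  "\<one>\<^bsub>xor_group\<^esub> = (False, False, False, False)"
  by (simp_all add: xor_group_def)

lemma group_xor_group: "group xor_group"
  by (rule groupI) (auto simp: xor_group_simps)

text \<open>Here \<open>a\<close>, \<open>b\<close> and \<open>c\<close>, \<open>d\<close> are two
  mutually orthogonal hyperbolic pairs. The last assumption says that they detect the radical of the
  form, which is the centre, so their images are a basis of the central quotient.\<close>

locale symplectic_group = two_commutator_group +
  fixes a b c d
  assumes basis_closed [simp]: "a \<in> carrier G" "b \<in> carrier G" "c \<in> carrier G" "d \<in> carrier G"
    and basis_nc: "nc a b" "nc c d" "\<not> nc a c" "\<not> nc a d" "\<not> nc b c" "\<not> nc b d"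
    and center_if_orthogonal:
      "\<lbrakk>g \<in> carrier G; \<not> nc g a; \<not> nc g b; \<not> nc g c; \<not> nc g d\<rbrakk> \<Longrightarrow> g \<in> group_center G"
begin

lemma basis_nc_sym: "nc b a" "nc d c" "\<not> nc c a" "\<not> nc d a" "\<not> nc c b" "\<not> nc d b"
  using basis_nc by (simp_all add: nc_sym)

definition coord where "coord g = (nc g a, nc g b, nc g c, nc g d)"

text \<open>Pairing with \<open>a\<close> detects the exponent of \<open>b\<close> and vice versa,
  so the letters are crossed within each pair; this makes \<open>combination\<close> a right inverse
  of \<open>coord\<close>.\<close>

fun combination where
  "combination (p, q, r, s) =
    (if q then a else \<one>) \<otimes> (if p then b else \<one>) \<otimes> (if s then c else \<one>) \<otimes> (if r then d else \<one>)"

lemma combination_closed [simp]: "combination v \<in> carrier G"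
  by (cases v) simp

lemma nc_combination:
  assumes "h \<in> carrier G"
  shows "nc (combination (p, q, r, s)) h \<longleftrightarrow>
    (((q \<and> nc a h) \<noteq> (p \<and> nc b h)) \<noteq> (s \<and> nc c h)) \<noteq> (r \<and> nc d h)"
  using assms by (simp add: nc_mult_left)

lemma coord_combination: "coord (combination v) = v"
  by (cases v) (simp add: coord_def nc_combination basis_nc basis_nc_sym del: combination.simps)

lemma coord_mult:
  assumes "g \<in> carrier G" "h \<in> carrier G"
  shows "coord (g \<otimes> h) = coord g \<otimes>\<^bsub>xor_group\<^esub> coord h"
  using assms by (simp add: coord_def xor_group_simps nc_mult_left)

lemma coord_hom: "group_hom G xor_group coord"
  by (intro group_hom.intro group_hom_axioms.intro homI)
    (simp_all add: coord_mult xor_group_simps(1) is_group group_xor_group)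

lemma coord_surj: "coord ` carrier G = UNIV"
  by (metis UNIV_eq_I combination_closed coord_combination imageI)

lemma coord_kernel: "kernel G xor_group coord = group_center G"
  using center_if_orthogonal
  by (auto simp: kernel_def coord_def xor_group_simps center_in_carrier nc_center)

text \<open>The right-hand side is the standard symplectic form in coordinates. Modulo the centre,
  \<open>g\<close> may be replaced by the combination of basis elements with the same
  coordinates.\<close>

lemma nc_coord:
  assumes "g \<in> carrier G" "h \<in> carrier G"
  shows "nc g h \<longleftrightarrow>
    (case (coord g, coord h) of ((p, q, r, s), (p', q', r', s')) \<Rightarrow>
      (((q \<and> p') \<noteq> (p \<and> q')) \<noteq> (s \<and> r')) \<noteq> (r \<and> s'))"
proof -
  \<comment> \<open>The two factors have equal coordinates, which cancel modulo 2; hence the product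
    is central.\<close>
  have "coord (g \<otimes> combination (coord g)) = \<one>\<^bsub>xor_group\<^esub>"
    using assms by (cases "coord g") (simp add: coord_mult coord_combination xor_group_simps del: combination.simps)
  then have "g \<otimes> combination (coord g) \<in> group_center G"
    using assms by (simp add: coord_kernel[symmetric] kernel_def)
  then have "nc g h \<longleftrightarrow> nc (combination (coord g)) h"
    using assms nc_mult_left[of g "combination (coord g)" h] nc_center by auto
  then show ?thesis
    using nc_combination[OF assms(2), of "nc g a" "nc g b" "nc g c" "nc g d"]
    by (simp add: coord_def nc_sym[of h] del: combination.simps)
qed

lemma coord_coset_iso:
  "(\<lambda>S. the_elem (coord ` S)) \<in> iso (G Mod group_center G) xor_group"
  using group_hom.FactGroup_iso_set[OF coord_hom] coord_surj
  by (simp add: coord_kernel xor_group_simps)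

lemma coord_coset:
  assumes "g \<in> carrier G"
  shows "the_elem (coord ` (group_center G #> g)) = coord g"
proof -
  have "coord x = coord g" if "x \<in> group_center G #> g" for x
    using that assms
    by (auto simp: r_coset_def coord_def nc_mult_left nc_center center_in_carrier)
  moreover have "g \<in> group_center G #> g"
    using assms center_subgroup by (rule rcos_self)
  ultimately have "coord ` (group_center G #> g) = {coord g}" by blast
  then show ?thesis by simp
qed

lemma derived_eq_t: "derived G (carrier G) = {\<one>, t}"
  by (rule derived_eq[OF basis_closed(1,2) basis_nc(1)])

end

text \<open>Coordinates identify both central quotients with \<open>xor_group\<close>, and by
  \<open>nc_coord\<close> the form looks the same in both groups.\<close>

lemma symplectic_groups_isoclinic:
  fixes G :: "('a, 'b) monoid_scheme" and H :: "('c, 'd) monoid_scheme"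
  assumes "symplectic_group G t a b c d" "symplectic_group H t' a' b' c' d'"
  shows "isoclinic G H"
proof -
  interpret G: symplectic_group G t a b c d by fact
  interpret H: symplectic_group H t' a' b' c' d' by fact
  let ?f = "\<lambda>S. the_elem (G.coord ` S)" and ?k = "\<lambda>S. the_elem (H.coord ` S)"
  \<comment> \<open>A coset goes to the coset with the same coordinates, and the nontrivial
    commutator of one group to that of the other.\<close>
  define \<theta> where "\<theta> = inv_into (carrier (H Mod group_center H)) ?k \<circ> ?f"
  define \<phi> where "\<phi> x = (if x = \<one>\<^bsub>G\<^esub> then \<one>\<^bsub>H\<^esub> else t')" for x
  have "inv_into (carrier (H Mod group_center H)) ?k \<in> iso xor_group (H Mod group_center H)"
    by (rule group.iso_set_sym[OF normal.factorgroup_is_group[OF H.center_normal] H.coord_coset_iso])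
  then have \<theta>: "\<theta> \<in> iso (G Mod group_center G) (H Mod group_center H)"
    unfolding \<theta>_def by (intro iso_set_trans[OF G.coord_coset_iso])
  have \<phi>: "\<phi> \<in> iso (G\<lparr>carrier := derived G (carrier G)\<rparr>) (H\<lparr>carrier := derived H (carrier H)\<rparr>)"
    unfolding iso_def hom_def bij_betw_def
    using G.t_nontrivial H.t_nontrivial
    by (auto simp: G.derived_eq_t H.derived_eq_t \<phi>_def G.t_square H.t_square)
  have coord: "H.coord x' = G.coord x"
    if "x \<in> carrier G" "x' \<in> carrier H"
      and eq: "group_center H #>\<^bsub>H\<^esub> x' = \<theta> (group_center G #>\<^bsub>G\<^esub> x)" for x x'
  proof -
    have "?k ` carrier (H Mod group_center H) = UNIV"
      using H.coord_coset_iso by (auto simp: iso_def bij_betw_def xor_group_simps)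
    then have "?k (\<theta> (group_center G #>\<^bsub>G\<^esub> x)) = ?f (group_center G #>\<^bsub>G\<^esub> x)"
      unfolding \<theta>_def comp_def by (intro f_inv_into_f) simp
    then show ?thesis
      using G.coord_coset[OF that(1)] H.coord_coset[OF that(2)] by (simp add: eq[symmetric])
  qed
  show ?thesis
    unfolding isoclinic_def
  proof (intro exI conjI ballI impI)
    fix x y x' y'
    assume "x \<in> carrier G" "y \<in> carrier G" "x' \<in> carrier H" "y' \<in> carrier H"
      "group_center H #>\<^bsub>H\<^esub> x' = \<theta> (group_center G #>\<^bsub>G\<^esub> x)"
      "group_center H #>\<^bsub>H\<^esub> y' = \<theta> (group_center G #>\<^bsub>G\<^esub> y)"
    then have "H.nc x' y' \<longleftrightarrow> G.nc x y"
      by (simp add: G.nc_coord H.nc_coord coord)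
    then show "\<phi> (commutator G x y) = commutator H x' y'"
      using \<open>x \<in> _\<close> \<open>y \<in> _\<close> \<open>x' \<in> _\<close> \<open>y' \<in> _\<close> G.t_nontrivial
      by (simp add: G.commutator_nc H.commutator_nc \<phi>_def)
  qed (fact \<theta> \<phi>)+
qed

text \<open>Isoclinism carries the central quotient over to \<open>H\<close>, where it is again
  \<open>xor_group\<close>: it has 16 elements, and being abelian it puts gh and hg in the same
  coset of the centre.\<close>

lemma (in symplectic_group) isoclinic_center:
  fixes H :: "('c, 'd) monoid_scheme"
  assumes "group H" "finite (carrier H)" "isoclinic H G"
  shows "order H = 16 * card (group_center H)"
    and "\<lbrakk>g \<in> carrier H; h \<in> carrier H\<rbrakk> \<Longrightarrow> commutator H g h \<in> group_center H"
proof -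
  interpret H: group H by fact
  let ?Z = "group_center H"
  obtain \<theta> where "\<theta> \<in> iso (H Mod ?Z) (G Mod group_center G)"
    using assms(3) unfolding isoclinic_def by blast
  then obtain \<psi> where \<psi>: "\<psi> \<in> iso (H Mod ?Z) xor_group"
    using coord_coset_iso iso_set_trans by blast
  have bij: "bij_betw \<psi> (rcosets\<^bsub>H\<^esub> ?Z) UNIV"
    using \<psi> by (simp add: iso_def FactGroup_def xor_group_simps)
  have "card (rcosets\<^bsub>H\<^esub> ?Z) = card (UNIV :: (bool \<times> bool \<times> bool \<times> bool) set)"
    using bij by (rule bij_betw_same_card)
  also have "\<dots> = 16"
    by (simp add: UNIV_Times_UNIV[symmetric] card_cartesian_product del: UNIV_Times_UNIV)
  finally show "order H = 16 * card ?Z"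
    using H.lagrange[OF H.center_subgroup] by simp
  show "commutator H g h \<in> ?Z" if gh: "g \<in> carrier H" "h \<in> carrier H"
  proof -
    have \<psi>_mult: "\<psi> (?Z #>\<^bsub>H\<^esub> (x \<otimes>\<^bsub>H\<^esub> y)) = \<psi> (?Z #>\<^bsub>H\<^esub> x) \<otimes>\<^bsub>xor_group\<^esub> \<psi> (?Z #>\<^bsub>H\<^esub> y)"
      if "x \<in> carrier H" "y \<in> carrier H" for x y
      using \<psi> that normal.rcos_sum[OF H.center_normal that, symmetric]
      by (auto simp: iso_def hom_def carrier_FactGroup)
    have "u \<otimes>\<^bsub>xor_group\<^esub> v = v \<otimes>\<^bsub>xor_group\<^esub> u" for u v
      by (cases u; cases v) (auto simp: xor_group_simps)
    then have "\<psi> (?Z #>\<^bsub>H\<^esub> (g \<otimes>\<^bsub>H\<^esub> h)) = \<psi> (?Z #>\<^bsub>H\<^esub> (h \<otimes>\<^bsub>H\<^esub> g))"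
      using gh by (simp add: \<psi>_mult)
    then have "?Z #>\<^bsub>H\<^esub> (g \<otimes>\<^bsub>H\<^esub> h) = ?Z #>\<^bsub>H\<^esub> (h \<otimes>\<^bsub>H\<^esub> g)"
      using bij gh by (auto simp: bij_betw_def RCOSETS_def dest!: inj_onD)
    then have "g \<otimes>\<^bsub>H\<^esub> h \<in> ?Z #>\<^bsub>H\<^esub> (h \<otimes>\<^bsub>H\<^esub> g)"
      using H.rcos_self[OF _ H.center_subgroup] gh by blast
    then obtain z where z: "z \<in> ?Z" "g \<otimes>\<^bsub>H\<^esub> h = z \<otimes>\<^bsub>H\<^esub> (h \<otimes>\<^bsub>H\<^esub> g)"
      by (auto simp: r_coset_def)
    then have "commutator H g h = z"
      using gh z(2) H.center_commute[OF z(1), of "h \<otimes>\<^bsub>H\<^esub> g"] H.center_in_carrier[OF z(1)]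
      by (intro H.commutator_unique) simp_all
    with z show ?thesis by simp
  qed
qed

text \<open>By \<open>sep\<close>, different elements of \<open>C\<close> lie in different right
  cosets of \<open>H\<close>, so the products of \<open>H\<close> and \<open>C\<close> are distinct
  elements of \<open>K\<close>. This gives all lower bounds on centralizers below.\<close>

lemma (in group) card_mult_le:
  assumes H: "subgroup H G" and K: "subgroup K G" and "H \<subseteq> K" "C \<subseteq> K" "finite K"
    and sep: "\<And>x y. \<lbrakk>x \<in> C; y \<in> C; x \<otimes> inv y \<in> H\<rbrakk> \<Longrightarrow> x = y"
  shows "card C * card H \<le> card K"
proof -
  have carrier: "x \<in> carrier G" if "x \<in> K" for x
    using that subgroup.mem_carrier[OF K] by simp
  have "inj_on (\<lambda>(h, x). h \<otimes> x) (H \<times> C)"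
  proof (rule inj_onI, clarify)
    fix h x h' x'
    assume in_sets: "h \<in> H" "x \<in> C" "h' \<in> H" "x' \<in> C" and eq: "h \<otimes> x = h' \<otimes> x'"
    then have closed: "h \<in> carrier G" "x \<in> carrier G" "h' \<in> carrier G" "x' \<in> carrier G"
      using assms(3,4) carrier by blast+
    have "x \<otimes> inv x' = inv h \<otimes> (h \<otimes> x) \<otimes> inv x'"
      using closed by (simp add: m_assoc[symmetric])
    also have "\<dots> = inv h \<otimes> h'"
      using closed by (simp add: eq m_assoc)
    finally have "x \<otimes> inv x' \<in> H"
      using in_sets H by (simp add: subgroup.m_closed subgroup.m_inv_closed)
    then have "x = x'" using sep in_sets by blast
    with eq closed show "h = h' \<and> x = x'" by simp
  qed
  moreover have "(\<lambda>(h, x). h \<otimes> x) ` (H \<times> C) \<subseteq> K"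
    using assms(3,4) subgroup.m_closed[OF K] by auto
  ultimately have "card (H \<times> C) \<le> card K"
    using \<open>finite K\<close> by (rule card_inj_on_le)
  then show ?thesis
    by (simp add: card_cartesian_product mult.commute)
qed

section \<open>Orthogonal complements and existence of a symplectic basis\<close>

context two_commutator_group
begin

definition orth where "orth A = {g \<in> carrier G. \<forall>x \<in> A. \<not> nc g x}"

lemma orth_subgroup:
  assumes "A \<subseteq> carrier G"
  shows "subgroup (orth A) G"
  by (rule subgroupI) (use assms in \<open>auto simp: orth_def nc_inv nc_mult_left subset_iff intro!: exI[of _ "\<one>"]\<close>)

text \<open>Pairing with \<open>a\<close> is a homomorphism from \<open>orth A\<close> to a group of
  order two. Its kernel is the smaller complement, and \<open>b\<close> shows that it is
  onto.\<close>

lemma card_orth_insert: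
  assumes "finite (carrier G)" "A \<subseteq> carrier G" "a \<in> carrier G" "b \<in> orth A" "nc a b"
  shows "card (orth A) = 2 * card (orth (insert a A))" (is "card ?K = 2 * card ?H")
proof (rule antisym)
  have K: "subgroup ?K G" "finite ?K" and H: "subgroup ?H G" "finite ?H"
    using assms by (simp_all add: orth_subgroup) (simp_all add: orth_def)
  have b: "b \<in> carrier G" "inv b \<in> ?K" "nc b a"
    using assms subgroup.m_inv_closed[OF K(1)] by (auto simp: orth_def nc_sym)
  have "?K \<subseteq> ?H \<union> (\<lambda>h. h \<otimes> b) ` ?H"
  proof
    fix k assume k: "k \<in> ?K"
    then have "k \<in> carrier G" by (simp add: orth_def)
    show "k \<in> ?H \<union> (\<lambda>h. h \<otimes> b) ` ?H"
    proof (cases "nc k a")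
      case True
      have "k \<otimes> inv b \<in> ?H"
        using k b assms True subgroup.m_closed[OF K(1) k b(2)]
        by (auto simp: orth_def nc_mult_left nc_inv)
      moreover have "k = k \<otimes> inv b \<otimes> b"
        using b \<open>k \<in> carrier G\<close> by (simp add: m_assoc)
      ultimately show ?thesis by blast
    qed (use k in \<open>auto simp: orth_def\<close>)
  qed
  then have "card ?K \<le> card (?H \<union> (\<lambda>h. h \<otimes> b) ` ?H)"
    using H by (intro card_mono) auto
  also have "\<dots> \<le> card ?H + card ?H"
    using card_Un_le[of ?H "(\<lambda>h. h \<otimes> b) ` ?H"] card_image_le[OF H(2), of "\<lambda>h. h \<otimes> b"] by linarith
  finally show "card ?K \<le> 2 * card ?H" by simp
  have "\<one> \<noteq> b" using b assms by auto
  have "card {\<one>, b} * card ?H \<le> card ?K"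
  proof (rule card_mult_le[OF H(1) K(1) _ _ K(2)])
    show "{\<one>, b} \<subseteq> ?K"
      using assms subgroup.one_closed[OF K(1)] by simp
    fix x y assume "x \<in> {\<one>, b}" "y \<in> {\<one>, b}" "x \<otimes> inv y \<in> ?H"
    then show "x = y"
      using b assms by (auto simp: orth_def nc_inv)
  qed (auto simp: orth_def)
  then show "2 * card ?H \<le> card ?K"
    using \<open>\<one> \<noteq> b\<close> by simp
qed

text \<open>Two hyperbolic pairs are split off one after the other, and the complements have 32, 16,
  8, 4 and 2 elements. The bound on the centre ensures that the complement of the first pair still
  has a noncentral element.\<close>

lemma exists_symplectic_basis:
  assumes order: "order G = 32" and center: "card (group_center G) \<le> 4"
  shows "\<exists>a b c d. symplectic_group G t a b c d"
proof -
  have fin: "finite (carrier G)"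
    using order order_gt_0_iff_finite by simp
  have fin_orth: "finite (orth A)" for A
    using fin by (simp add: orth_def)
  have orth_closed: "x \<in> carrier G" if "x \<in> orth A" for x A
    using that by (simp add: orth_def)
  have center_orth: "group_center G \<subseteq> orth A" if "A \<subseteq> carrier G" for A
    using that by (auto simp: orth_def center_iff)
  have orth_not_center: "\<exists>x \<in> orth A. x \<notin> group_center G" if "card (orth A) > 4" for A
  proof (rule ccontr)
    assume "\<not> ?thesis"
    then have "orth A \<subseteq> group_center G" by blast
    then have "card (orth A) \<le> card (group_center G)"
      by (rule card_mono[rotated]) (use fin in \<open>auto simp: group_center_def\<close>)
    with that center show False by simp
  qed
  have card0: "card (orth {}) = 32"
    using order by (simp add: orth_def order_def)
  obtain a where a: "a \<in> carrier G" "a \<notin> group_center G"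
    using orth_not_center[of "{}"] card0 orth_closed by auto
  then obtain b where b: "b \<in> carrier G" "nc a b"
    by (auto simp: center_iff)
  have "card (orth {}) = 2 * card (orth {a})"
    using a b fin by (intro card_orth_insert) (auto simp: orth_def)
  moreover have "card (orth {a}) = 2 * card (orth {b, a})"
    using a b fin by (intro card_orth_insert[of _ _ a]) (auto simp: orth_def nc_sym)
  ultimately have card2: "card (orth {b, a}) = 8"
    using card0 by simp
  obtain c where c: "c \<in> orth {b, a}" "c \<notin> group_center G"
    using orth_not_center[of "{b, a}"] card2 by auto
  then have c': "c \<in> carrier G" "\<not> nc c a" "\<not> nc c b" "\<not> nc a c" "\<not> nc b c"
    by (auto simp: orth_def nc_sym)
  then obtain h where h: "h \<in> carrier G" "nc c h"
    using c by (auto simp: center_iff)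
  \<comment> \<open>The factors \<open>b\<close> and \<open>a\<close> remove the pairing of
    \<open>h\<close> with the first pair; they are orthogonal to \<open>c\<close>, so
    \<open>d\<close> still pairs nontrivially with \<open>c\<close>.\<close>
  define d where "d = h \<otimes> (if nc h a then b else \<one>) \<otimes> (if nc h b then a else \<one>)"
  have d: "d \<in> carrier G" "\<not> nc d a" "\<not> nc d b" "nc d c"
    using a b c' h nc_sym[of a b] nc_sym[of h c] by (auto simp: d_def nc_mult_left)
  have d_sym: "\<not> nc a d" "\<not> nc b d" "nc c d"
    using d nc_sym by blast+
  have "card (orth {b, a}) = 2 * card (orth {c, b, a})"
    using a b c' d d_sym fin by (intro card_orth_insert[of _ _ d]) (auto simp: orth_def)
  moreover have "card (orth {c, b, a}) = 2 * card (orth {d, c, b, a})"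
    using a b c' d d_sym fin by (intro card_orth_insert[of _ _ c]) (auto simp: orth_def)
  ultimately have "card (orth {d, c, b, a}) = card {\<one>, t}"
    using card2 t_nontrivial by simp
  moreover have "{\<one>, t} \<subseteq> group_center G"
    using t_center subgroup.one_closed[OF center_subgroup] by simp
  moreover have "group_center G \<subseteq> orth {d, c, b, a}"
    using a b c' d by (intro center_orth) simp
  \<comment> \<open>The centre lies between \<one>, \<open>t\<close> and the final complement; both
    ends have two elements, so all three agree and the form is nondegenerate modulo the
    centre.\<close>
  ultimately have "orth {d, c, b, a} = {\<one>, t}"
    by (intro card_subset_eq[OF fin_orth, symmetric]) auto
  with \<open>{\<one>, t} \<subseteq> group_center G\<close> have "orth {d, c, b, a} \<subseteq> group_center G"
    by simp
  then have "symplectic_group G t a b c d"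
    using a b c' d d_sym by unfold_locales (auto simp: orth_def)
  then show ?thesis by blast
qed

end

section \<open>The group \<open>G43\<close>\<close>

context group
begin

lemma center_if_commutes_generators:
  assumes "S \<subseteq> carrier G" "generate G S = carrier G" "g \<in> carrier G"
    and "\<And>s. s \<in> S \<Longrightarrow> g \<otimes> s = s \<otimes> g"
  shows "g \<in> group_center G"
proof -
  have "generate G S \<subseteq> {h \<in> carrier G. h \<otimes> g = g \<otimes> h}"
    using assms centralizer_subgroup by (intro generate_subgroup_incl) auto
  then show ?thesis
    using assms by (auto simp: group_center_def)
qed

text \<open>The factors picked up by a product multiply inside the central group formed by \<one>
  and \<open>t\<close>. Thus commutation up to \<open>t\<close> need only be checked on
  generators.\<close>

lemma swap_subgroup:
  assumes t: "t \<in> group_center G" "t \<otimes> t = \<one>" and a: "a \<in> carrier G"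
  shows "subgroup {g \<in> carrier G. g \<otimes> a = a \<otimes> g \<or> g \<otimes> a = a \<otimes> g \<otimes> t} G" (is "subgroup ?S G")
proof -
  \<comment> \<open>Quantifying over \<open>E\<close> turns the two alternatives into one equation
    with an unknown central factor.\<close>
  define E where "E = {\<one>, t}"
  have tc: "t \<in> carrier G" using t center_in_carrier by simp
  have S: "g \<in> ?S \<longleftrightarrow> g \<in> carrier G \<and> (\<exists>e \<in> E. g \<otimes> a = a \<otimes> g \<otimes> e)" for g
    using a by (auto simp: E_def)
  have E: "e \<in> carrier G" "e \<otimes> e = \<one>" if "e \<in> E" for e
    using that t(2) tc by (auto simp: E_def)
  have E_commute: "e \<otimes> g = g \<otimes> e" if "e \<in> E" "g \<in> carrier G" for e g
    using that t(1) center_commute by (auto simp: E_def)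
  have E_mult: "e \<otimes> e' \<in> E" if "e \<in> E" "e' \<in> E" for e e'
    using that t(2) tc by (auto simp: E_def)
  show ?thesis
  proof (rule subgroupI)
    show "?S \<noteq> {}"
      using a by (auto intro!: exI[of _ "\<one>"])
  next
    fix g assume "g \<in> ?S"
    then obtain e where g: "g \<in> carrier G" and e: "e \<in> E" "g \<otimes> a = a \<otimes> g \<otimes> e"
      unfolding S by blast
    have ga: "g \<otimes> a \<otimes> e = a \<otimes> g"
      using e g a E[OF e(1)] by (simp add: m_assoc)
    have "inv g \<otimes> a = inv g \<otimes> (a \<otimes> g) \<otimes> inv g"
      using g a by (simp add: m_assoc)
    also have "\<dots> = inv g \<otimes> (g \<otimes> a \<otimes> e) \<otimes> inv g"
      by (simp add: ga)
    also have "\<dots> = a \<otimes> (e \<otimes> inv g)"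
      using g a E[OF e(1)] by (simp add: m_assoc[symmetric])
    also have "\<dots> = a \<otimes> inv g \<otimes> e"
      using g a E[OF e(1)] by (simp add: E_commute[OF e(1), of "inv g"] m_assoc)
    finally show "inv g \<in> ?S"
      using e g unfolding S by auto
  next
    fix g h assume "g \<in> ?S" "h \<in> ?S"
    then obtain e e' where g: "g \<in> carrier G" "h \<in> carrier G"
      and e: "e \<in> E" "g \<otimes> a = a \<otimes> g \<otimes> e" and e': "e' \<in> E" "h \<otimes> a = a \<otimes> h \<otimes> e'"
      unfolding S by blast
    have "g \<otimes> h \<otimes> a = (g \<otimes> a) \<otimes> h \<otimes> e'"
      using g a E(1)[OF e'(1)] e'(2) by (simp add: m_assoc)
    also have "\<dots> = a \<otimes> g \<otimes> (e \<otimes> h) \<otimes> e'"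
      using g a E(1)[OF e'(1)] E(1)[OF e(1)] by (simp add: e(2) m_assoc)
    also have "\<dots> = a \<otimes> (g \<otimes> h) \<otimes> (e \<otimes> e')"
      using g a E(1)[OF e'(1)] E(1)[OF e(1)] by (simp add: E_commute[OF e(1), of h] m_assoc)
    finally show "g \<otimes> h \<in> ?S"
      using g E_mult[OF e(1) e'(1)] unfolding S by auto
  qed auto
qed

text \<open>The subgroup argument of \<open>swap_subgroup\<close> is applied to each of the two
  arguments in turn, with \<open>sym\<close> exchanging their roles.\<close>

lemma mult_swap_if_generators:
  assumes t: "t \<in> group_center G" "t \<otimes> t = \<one>"
    and S: "S \<subseteq> carrier G" "generate G S = carrier G"
    and swap: "\<And>r s. \<lbrakk>r \<in> S; s \<in> S\<rbrakk> \<Longrightarrow> r \<otimes> s = s \<otimes> r \<or> r \<otimes> s = s \<otimes> r \<otimes> t"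
    and gh: "g \<in> carrier G" "h \<in> carrier G"
  shows "g \<otimes> h = h \<otimes> g \<or> g \<otimes> h = h \<otimes> g \<otimes> t"
proof -
  have tc: "t \<in> carrier G" using t center_in_carrier by simp
  have sym: "y \<otimes> x = x \<otimes> y \<or> y \<otimes> x = x \<otimes> y \<otimes> t"
    if "x \<otimes> y = y \<otimes> x \<or> x \<otimes> y = y \<otimes> x \<otimes> t" "x \<in> carrier G" "y \<in> carrier G" for x y
    using that tc t(2) by (metis m_assoc m_closed r_one)
  have *: "generate G S \<subseteq> {x \<in> carrier G. x \<otimes> a = a \<otimes> x \<or> x \<otimes> a = a \<otimes> x \<otimes> t}"
    if "a \<in> carrier G" "\<And>s. s \<in> S \<Longrightarrow> s \<otimes> a = a \<otimes> s \<or> s \<otimes> a = a \<otimes> s \<otimes> t" for a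
    using that S(1) by (intro generate_subgroup_incl[OF _ swap_subgroup[OF t that(1)]]) blast
  have "x \<otimes> s = s \<otimes> x \<or> x \<otimes> s = s \<otimes> x \<otimes> t" if "x \<in> carrier G" "s \<in> S" for x s
    using *[of s] swap that S by blast
  then have "s \<otimes> h = h \<otimes> s \<or> s \<otimes> h = h \<otimes> s \<otimes> t" if "s \<in> S" for s
    using sym[of h s] that S(1) gh(2) by blast
  then show ?thesis
    using *[of h] gh S(2) by blast
qed

text \<open>Extracts the symplectic structure from the relations of \<open>G43\<close>, with x, w
  and y, z as hyperbolic pairs. The inequality \<open>nontrivial\<close> does not follow from the
  equations and is supplied by an action.\<close>

lemma symplectic_if_relations:
  assumes closed: "x \<in> carrier G" "y \<in> carrier G" "z \<in> carrier G" "w \<in> carrier G"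
    and generated: "generate G {x, y, z, w} = carrier G"
    and squares: "x \<otimes> x = y \<otimes> y" "y \<otimes> y = z \<otimes> z"
    and nontrivial: "x \<otimes> x \<noteq> \<one>"
    and zy: "commutator G z y \<otimes> (x \<otimes> x) = \<one>" and wx: "commutator G w x \<otimes> (x \<otimes> x) = \<one>"
    and "commutator G x y = \<one>" "commutator G x z = \<one>"
      "commutator G y w = \<one>" "commutator G z w = \<one>"
  shows "symplectic_group G (x \<otimes> x) x w y z"
proof -
  define t where "t = x \<otimes> x"
  have t: "t \<in> carrier G" by (simp add: t_def closed)
  have commute: "x \<otimes> y = y \<otimes> x" "x \<otimes> z = z \<otimes> x" "y \<otimes> w = w \<otimes> y" "z \<otimes> w = w \<otimes> z"
    using assms by (simp_all add: commutator_eq_one_iff)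
  \<comment> \<open>The common square \<open>t\<close> is central: \<open>x\<close> commutes with
    \<open>y\<close> and \<open>z\<close>, and the same element written as the square of
    \<open>y\<close> commutes with \<open>w\<close>.\<close>
  have "(x \<otimes> x) \<otimes> y = y \<otimes> (x \<otimes> x)" "(x \<otimes> x) \<otimes> z = z \<otimes> (x \<otimes> x)"
    "(y \<otimes> y) \<otimes> w = w \<otimes> (y \<otimes> y)"
    using commute closed by (simp_all add: mult_commute_mult)
  moreover have "(x \<otimes> x) \<otimes> x = x \<otimes> (x \<otimes> x)"
    using closed by (simp add: m_assoc)
  ultimately have "t \<otimes> s = s \<otimes> t" if "s \<in> {x, y, z, w}" for s
    using that squares(1) by (auto simp: t_def)
  then have center: "t \<in> group_center G"
    using closed generated t by (intro center_if_commutes_generators[of "{x, y, z, w}"]) auto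
  define s where "s = inv t"
  have s: "s \<in> group_center G" "s \<in> carrier G"
    using center t subgroup.m_inv_closed[OF center_subgroup] by (simp_all add: s_def)
  have comm: "commutator G z y = s" "commutator G w x = s"
    unfolding s_def t_def using zy wx closed by (simp_all add: inv_equality[symmetric])
  have wx': "w \<otimes> x = x \<otimes> w \<otimes> s"
    using mult_commutator[of w x] closed comm by simp
  \<comment> \<open>Moving \<open>w\<close> past both factors of \<open>t\<close> produces s^2.
    Since \<open>t\<close> is central, s^2 = 1, so \<open>s\<close>, the inverse of
    \<open>t\<close>, equals \<open>t\<close>.\<close>
  have "w \<otimes> t = (w \<otimes> x) \<otimes> x"
    using closed by (simp add: t_def m_assoc)
  also have "\<dots> = x \<otimes> w \<otimes> (s \<otimes> x)"
    using closed s by (simp add: wx' m_assoc)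
  also have "\<dots> = x \<otimes> (w \<otimes> x) \<otimes> s"
    using closed s by (simp add: center_commute[OF s(1), of x] m_assoc)
  also have "\<dots> = t \<otimes> w \<otimes> (s \<otimes> s)"
    using closed s by (simp add: wx' t_def m_assoc)
  also have "t \<otimes> w = w \<otimes> t"
    using center closed(4) by (rule center_commute)
  finally have "s \<otimes> s = \<one>"
    using closed t s by simp
  then have "s = t"
    using inv_equality[of s s] s(2) t by (metis inv_inv s_def)
  then have tt: "t \<otimes> t = \<one>" using \<open>s \<otimes> s = \<one>\<close> by simp
  have noncommute: "w \<otimes> x = x \<otimes> w \<otimes> t" "x \<otimes> w = w \<otimes> x \<otimes> t"
    "z \<otimes> y = y \<otimes> z \<otimes> t" "y \<otimes> z = z \<otimes> y \<otimes> t"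
  proof -
    show wx: "w \<otimes> x = x \<otimes> w \<otimes> t" and zy: "z \<otimes> y = y \<otimes> z \<otimes> t"
      using mult_commutator[of w x] mult_commutator[of z y] closed comm \<open>s = t\<close> by simp_all
    show "x \<otimes> w = w \<otimes> x \<otimes> t" "y \<otimes> z = z \<otimes> y \<otimes> t"
      unfolding wx zy using closed t tt by (simp_all add: m_assoc)
  qed
  have swap: "r \<otimes> s = s \<otimes> r \<or> r \<otimes> s = s \<otimes> r \<otimes> t"
    if "r \<in> {x, y, z, w}" "s \<in> {x, y, z, w}" for r s
    using that by (elim insertE emptyE; hypsubst) (metis commute noncommute)+
  interpret two_commutator_group G t
  proof
    fix g h assume "g \<in> carrier G" "h \<in> carrier G"
    then show "g \<otimes> h = h \<otimes> g \<or> g \<otimes> h = h \<otimes> g \<otimes> t"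
      using closed by (intro mult_swap_if_generators[OF center tt _ generated swap]) auto
  qed (use center tt nontrivial in \<open>simp_all add: t_def\<close>)
  have "nc w x" "nc z y"
    using comm \<open>s = t\<close> t_nontrivial closed by (simp_all add: nc_def commutator_eq_one_iff[symmetric])
  then have "symplectic_group G t x w y z"
    using closed commute generated
    by unfold_locales (auto simp: nc_def intro!: center_if_commutes_generators[of "{x, y, z, w}"])
  then show ?thesis by (simp add: t_def)
qed

end

section \<open>Words, their actions, and nontriviality in the presented group\<close>

lemma presented_group_commutator:
  "commutator (presented_group R) (word_cong R `` {u}) (word_cong R `` {v}) =
    word_cong R `` {word_comm u v}"
proof -
  interpret group "presented_group R" by (rule group_presented_group)
  have "inv\<^bsub>presented_group R\<^esub> (word_cong R `` {u}) = word_cong R `` {word_inv u}" for u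
    by (rule inv_equality)
      (auto simp: carrier_presented_group mult_presented_group one_presented_group
        word_class_eq_iff word_inv_cong)
  then show ?thesis
    by (simp add: commutator_def word_comm_def mult_presented_group)
qed

lemma presented_group_generated:
  "generate (presented_group R) (range (\<lambda>g. word_cong R `` {[(g, True)]})) =
    carrier (presented_group R)" (is "generate ?P ?S = _")
proof -
  interpret group ?P by (rule group_presented_group)
  have S: "?S \<subseteq> carrier ?P" by (auto simp: carrier_presented_group)
  interpret gen: subgroup "generate ?P ?S" ?P by (rule generate_is_subgroup[OF S])
  have "word_cong R `` {w} \<in> generate ?P ?S" for w
  proof (induction w)
    case Nil
    show ?case using gen.one_closed by (simp add: one_presented_group)
  next
    case (Cons l w)
    obtain g e where l: "l = (g, e)" by (cases l)
    let ?g = "word_cong R `` {[(g, True)]}"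
    have g: "?g \<in> generate ?P ?S" by (rule generate.incl) blast
    have "inv\<^bsub>?P\<^esub> ?g = word_cong R `` {[(g, False)]}"
      by (rule inv_equality)
        (use word_cong.cancel[of g False R] in \<open>auto simp: carrier_presented_group
          mult_presented_group one_presented_group word_class_eq_iff\<close>)
    then have "word_cong R `` {[l]} \<in> generate ?P ?S"
      using g gen.m_inv_closed[OF g] by (cases e) (simp_all add: l)
    then show ?case
      using Cons gen.m_closed mult_presented_group[of R "[l]" w] by fastforce
  qed
  then show ?thesis
    using generate_incl[OF S] by (auto simp: carrier_presented_group)
qed

fun word_action :: "('g \<Rightarrow> 's \<Rightarrow> 's) \<Rightarrow> ('g \<Rightarrow> 's \<Rightarrow> 's) \<Rightarrow> 'g word \<Rightarrow> 's \<Rightarrow> 's" where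
  "word_action f f' [] p = p"
| "word_action f f' ((g, e) # w) p = (if e then f g else f' g) (word_action f f' w p)"

lemma word_action_append:
  "word_action f f' (u @ v) p = word_action f f' u (word_action f f' v p)"
  by (induction f f' u p rule: word_action.induct) auto

text \<open>An action that satisfies the relations is an invariant of congruence classes, so it can
  show that two words are not congruent.\<close>

lemma word_action_cong:
  assumes "(u, v) \<in> word_cong R"
    and "\<And>g p. f g (f' g p) = p" "\<And>g p. f' g (f g p) = p"
    and "\<And>u v p. (u, v) \<in> R \<Longrightarrow> word_action f f' u p = word_action f f' v p"
  shows "word_action f f' u p = word_action f f' v p"
  using assms(1)
  by (induction arbitrary: p) (auto simp: word_action_append assms(2-4))

text \<open>\<open>x\<close> and \<open>w\<close> act on signed basis vectors of a plane as a rotation and a reflection,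
  generating the dihedral group; \<open>y\<close> and \<open>z\<close> act on signed quaternion units
  \<open>1, i, j, k\<close>, encoded by \<open>(q, r)\<close>, as left multiplication by \<open>i\<close> and \<open>j\<close>.
  The sign \<open>s\<close> is shared by the two factors.\<close>

fun G43_action :: "gen \<Rightarrow> bool \<times> bool \<times> bool \<times> bool \<Rightarrow> bool \<times> bool \<times> bool \<times> bool" where
  "G43_action gen_x (p, q, r, s) = (\<not> p, q, r, s \<noteq> p)"
| "G43_action gen_w (p, q, r, s) = (p, q, r, s \<noteq> p)"
| "G43_action gen_y (p, q, r, s) = (p, \<not> q, r, s \<noteq> q)"
| "G43_action gen_z (p, q, r, s) = (p, q, \<not> r, (s \<noteq> q) \<noteq> r)"

definition G43_relations :: "(gen word \<times> gen word) set" where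
  "G43_relations =
    (let x = [(gen_x, True)]; y = [(gen_y, True)]; z = [(gen_z, True)]; w = [(gen_w, True)]
     in {(w @ w, []), (x @ x, y @ y), (y @ y, z @ z),
       (word_comm z y @ x @ x, []), (word_comm w x @ x @ x, []),
       (word_comm x y, []), (word_comm x z, []), (word_comm y w, []), (word_comm z w, [])})"

lemma UNIV_gen: "UNIV = {gen_x, gen_y, gen_z, gen_w}"
  using gen.exhaust by blast

lemma G43_symplectic: "\<exists>t a b c d. symplectic_group G43 t a b c d"
proof -
  have G43: "G43 = presented_group G43_relations"
    by (simp add: G43_def G43_relations_def Let_def)
  define cls where "cls g = word_cong G43_relations `` {[(g, True)]}" for g
  interpret group G43
    unfolding G43 by (rule group_presented_group)
  have gens: "range cls = {cls gen_x, cls gen_y, cls gen_z, cls gen_w}"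
    by (subst UNIV_gen) simp
  have nontrivial: "cls gen_x \<otimes>\<^bsub>G43\<^esub> cls gen_x \<noteq> \<one>\<^bsub>G43\<^esub>"
  proof
    assume "cls gen_x \<otimes>\<^bsub>G43\<^esub> cls gen_x = \<one>\<^bsub>G43\<^esub>"
    then have x: "([(gen_x, True), (gen_x, True)], []) \<in> word_cong G43_relations"
      by (simp add: G43 cls_def mult_presented_group one_presented_group word_class_eq_iff)
    \<comment> \<open>Every generator acts with trivial fourth power, so its cube serves as the
      action of the inverse letter.\<close>
    let ?f = "G43_action" and ?f' = "\<lambda>g p. G43_action g (G43_action g (G43_action g p))"
    have ff: "G43_action g (G43_action g (G43_action g (G43_action g p))) = p" for g p
      by (cases g; cases p) auto
    have "word_action ?f ?f' u p = word_action ?f ?f' v p" if "(u, v) \<in> G43_relations" for u v p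
      using that by (cases p) (auto simp: G43_relations_def Let_def word_comm_def word_inv_def)
    \<comment> \<open>Applying \<open>gen_x\<close> twice returns to the starting point with the
      sign flipped.\<close>
    from word_action_cong[OF x, of ?f ?f' "(False, False, False, False)", OF ff ff this]
    show False by simp
  qed
  have "symplectic_group G43 (cls gen_x \<otimes>\<^bsub>G43\<^esub> cls gen_x) (cls gen_x) (cls gen_w) (cls gen_y) (cls gen_z)"
  proof (rule symplectic_if_relations[OF _ _ _ _ _ _ _ nontrivial])
    show "generate G43 {cls gen_x, cls gen_y, cls gen_z, cls gen_w} = carrier G43"
      using presented_group_generated[of G43_relations] gens by (simp add: G43 cls_def)
  qed (auto simp: G43 cls_def carrier_presented_group presented_group_commutator mult_presented_group
      one_presented_group word_class_eq_iff intro!: word_cong.rel, auto simp: G43_relations_def Let_def)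
  then show ?thesis by blast
qed

section \<open>Central automorphisms that preserve classes\<close>

context group
begin

text \<open>Centrality of the values of \<open>f\<close> makes the map multiplicative, and on a
  finite carrier injectivity gives bijectivity.\<close>

lemma Aut_zI:
  assumes fin: "finite (carrier G)"
    and f_center: "\<And>g. g \<in> carrier G \<Longrightarrow> f g \<in> group_center G"
    and f_mult: "\<And>g h. \<lbrakk>g \<in> carrier G; h \<in> carrier G\<rbrakk> \<Longrightarrow> f (g \<otimes> h) = f g \<otimes> f h"
    and inj: "\<And>g h. \<lbrakk>g \<in> carrier G; h \<in> carrier G; g \<otimes> f g = h \<otimes> f h\<rbrakk> \<Longrightarrow> g = h"
  shows "(\<lambda>g \<in> carrier G. g \<otimes> f g) \<in> Aut_z G" (is "?\<phi> \<in> _")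
proof -
  have closed: "f g \<in> carrier G" if "g \<in> carrier G" for g
    using f_center that center_in_carrier by blast
  have "?\<phi> \<in> hom G G"
  proof (rule homI)
    fix g h assume gh: "g \<in> carrier G" "h \<in> carrier G"
    have "g \<otimes> h \<otimes> (f g \<otimes> f h) = g \<otimes> (f g \<otimes> h) \<otimes> f h"
      using gh closed by (simp add: center_commute[OF f_center, of g h] m_assoc)
    also have "\<dots> = g \<otimes> f g \<otimes> (h \<otimes> f h)"
      using gh closed by (simp add: m_assoc)
    finally show "?\<phi> (g \<otimes> h) = ?\<phi> g \<otimes> ?\<phi> h"
      using gh by (simp add: f_mult)
  qed (simp add: closed)
  moreover have inj_on: "inj_on ?\<phi> (carrier G)"
    using inj by (intro inj_onI) simp
  have "?\<phi> ` carrier G = carrier G"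
    by (rule endo_inj_surj[OF fin _ inj_on]) (auto simp: closed)
  with inj_on have "?\<phi> \<in> Bij (carrier G)"
    by (simp add: Bij_def bij_betw_def)
  ultimately show ?thesis
    using f_center closed by (simp add: Aut_z_def auto_def m_assoc[symmetric])
qed

text \<open>The automorphism built from \<open>f\<close> preserves classes, and a conjugate of
  \<open>g\<close> is \<open>g\<close> times a commutator [g, h]; cancelling \<open>g\<close> leaves
  \<open>f g\<close>. This turns central automorphisms into conditions on commutators.\<close>

lemma central_hom_is_commutator:
  assumes "Aut_z G \<subseteq> Aut_c G" "finite (carrier G)"
    and "\<And>g. g \<in> carrier G \<Longrightarrow> f g \<in> group_center G"
    and "\<And>g h. \<lbrakk>g \<in> carrier G; h \<in> carrier G\<rbrakk> \<Longrightarrow> f (g \<otimes> h) = f g \<otimes> f h"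
    and "\<And>g h. \<lbrakk>g \<in> carrier G; h \<in> carrier G; g \<otimes> f g = h \<otimes> f h\<rbrakk> \<Longrightarrow> g = h"
    and g: "g \<in> carrier G"
  shows "\<exists>h \<in> carrier G. commutator G g h = f g"
proof -
  have "(\<lambda>g \<in> carrier G. g \<otimes> f g) \<in> Aut_c G"
    using assms(1) Aut_zI[OF assms(2-5)] by blast
  then obtain h where h: "h \<in> carrier G" "g \<otimes> f g = inv h \<otimes> g \<otimes> h"
    using g by (auto simp: Aut_c_def)
  have "g \<otimes> f g = g \<otimes> commutator G g h"
    using h g by (simp add: conj_eq_mult_commutator)
  then have "commutator G g h = f g"
    using g h center_in_carrier[OF assms(3)[OF g]] by simp
  with h show ?thesis by blast
qed

text \<open>Conjugation by \<open>h\<close> preserves classes and is therefore central; its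
  displacement at \<open>g\<close> is the commutator.\<close>

lemma commutator_center_if_Aut_c_le_Aut_z:
  assumes "Aut_c G \<subseteq> Aut_z G" "g \<in> carrier G" "h \<in> carrier G"
  shows "commutator G g h \<in> group_center G"
proof -
  let ?\<phi> = "\<lambda>x \<in> carrier G. inv h \<otimes> x \<otimes> h"
  have "?\<phi> \<in> hom G G"
  proof (rule homI)
    fix x y assume "x \<in> carrier G" "y \<in> carrier G"
    moreover from this have "inv h \<otimes> x \<otimes> h \<otimes> (inv h \<otimes> y \<otimes> h) = inv h \<otimes> x \<otimes> (h \<otimes> inv h) \<otimes> y \<otimes> h"
      using assms(3) by (simp only: m_assoc m_closed inv_closed)
    ultimately show "?\<phi> (x \<otimes> y) = ?\<phi> x \<otimes> ?\<phi> y"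
      using assms(3) by (simp add: m_assoc)
  qed (use assms in simp)
  moreover have "bij_betw ?\<phi> (carrier G) (carrier G)"
  proof (rule bij_betw_byWitness[where f' = "\<lambda>x. h \<otimes> x \<otimes> inv h"])
    show "\<forall>x \<in> carrier G. h \<otimes> ?\<phi> x \<otimes> inv h = x" "\<forall>x \<in> carrier G. ?\<phi> (h \<otimes> x \<otimes> inv h) = x"
      using assms(3) by (auto simp: m_assoc) (auto simp: m_assoc[symmetric])
  qed (use assms in auto)
  ultimately have "?\<phi> \<in> Aut_c G"
    using assms(3) by (auto simp: Aut_c_def auto_def Bij_def)
  then have "inv g \<otimes> (inv h \<otimes> g \<otimes> h) \<in> group_center G"
    using assms by (auto simp: Aut_z_def)
  then show ?thesis
    using assms by (simp add: commutator_def m_assoc)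
qed

end

section \<open>Groups of class at most two: bilinear commutators and central squares\<close>

locale class_two_group = group +
  assumes commutator_center: "\<lbrakk>g \<in> carrier G; h \<in> carrier G\<rbrakk> \<Longrightarrow> commutator G g h \<in> group_center G"
begin

lemma commutator_commute:
  "\<lbrakk>g \<in> carrier G; h \<in> carrier G; x \<in> carrier G\<rbrakk> \<Longrightarrow> commutator G g h \<otimes> x = x \<otimes> commutator G g h"
  using commutator_center center_commute by blast

lemma commutator_mult_left:
  assumes "x \<in> carrier G" "y \<in> carrier G" "g \<in> carrier G"
  shows "commutator G (x \<otimes> y) g = commutator G x g \<otimes> commutator G y g"
proof (rule commutator_unique)
  have "x \<otimes> y \<otimes> g = (x \<otimes> g) \<otimes> y \<otimes> commutator G y g"
    using assms mult_commutator[of y g] by (simp add: m_assoc)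
  also have "\<dots> = g \<otimes> x \<otimes> (commutator G x g \<otimes> y) \<otimes> commutator G y g"
    using assms mult_commutator[of x g] by (simp add: m_assoc)
  also have "\<dots> = g \<otimes> (x \<otimes> y) \<otimes> (commutator G x g \<otimes> commutator G y g)"
    using assms by (simp add: commutator_commute[of x g y] m_assoc)
  finally show "x \<otimes> y \<otimes> g = g \<otimes> (x \<otimes> y) \<otimes> (commutator G x g \<otimes> commutator G y g)" .
qed (use assms in auto)

lemma commutator_mult_right:
  assumes "x \<in> carrier G" "y \<in> carrier G" "g \<in> carrier G"
  shows "commutator G g (x \<otimes> y) = commutator G g x \<otimes> commutator G g y"
proof (rule commutator_unique)
  have "g \<otimes> (x \<otimes> y) = (g \<otimes> x) \<otimes> y"
    using assms by (simp add: m_assoc)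
  also have "\<dots> = x \<otimes> g \<otimes> (commutator G g x \<otimes> y)"
    using assms mult_commutator[of g x] by (simp add: m_assoc)
  also have "\<dots> = x \<otimes> (g \<otimes> y) \<otimes> commutator G g x"
    using assms by (simp add: commutator_commute[of g x y] m_assoc)
  also have "\<dots> = x \<otimes> y \<otimes> g \<otimes> (commutator G g y \<otimes> commutator G g x)"
    using assms mult_commutator[of g y] by (simp add: m_assoc)
  also have "commutator G g y \<otimes> commutator G g x = commutator G g x \<otimes> commutator G g y"
    using assms by (intro commutator_commute) auto
  finally show "g \<otimes> (x \<otimes> y) = x \<otimes> y \<otimes> g \<otimes> (commutator G g x \<otimes> commutator G g y)" .
qed (use assms in auto)

lemma commutator_self: "g \<in> carrier G \<Longrightarrow> commutator G g g = \<one>"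
  by (simp add: commutator_eq_one_iff)

text \<open>Polarization: expand the trivial commutator of gh with itself.\<close>

lemma commutator_swap:
  assumes "g \<in> carrier G" "h \<in> carrier G"
  shows "commutator G h g \<otimes> commutator G g h = \<one>"
proof -
  have "commutator G (g \<otimes> h) (g \<otimes> h) = commutator G g (g \<otimes> h) \<otimes> commutator G h (g \<otimes> h)"
    using assms by (intro commutator_mult_left) auto
  also have "\<dots> = commutator G g h \<otimes> commutator G h g"
    using assms by (simp add: commutator_mult_right commutator_self)
  also have "\<dots> = commutator G h g \<otimes> commutator G g h"
    using assms by (intro commutator_commute) auto
  finally have "commutator G (g \<otimes> h) (g \<otimes> h) = commutator G h g \<otimes> commutator G g h" .
  then show ?thesis using assms by (simp add: commutator_self)
qed

lemma commutator_center_left: "z \<in> group_center G \<Longrightarrow> g \<in> carrier G \<Longrightarrow> commutator G z g = \<one>"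
  by (simp add: commutator_eq_one_iff center_commute center_in_carrier)

lemma commutator_center_right: "z \<in> group_center G \<Longrightarrow> g \<in> carrier G \<Longrightarrow> commutator G g z = \<one>"
  by (simp add: commutator_eq_one_iff center_commute center_in_carrier)

lemma not_centerE:
  assumes "g \<in> carrier G" "g \<notin> group_center G"
  obtains h where "h \<in> carrier G" "commutator G g h \<noteq> \<one>"
  using assms by (auto simp: group_center_def commutator_eq_one_iff)

text \<open>A noncentral square \<open>a\<^sup>2\<close> forces both \<open>3 |Z| \<le> |C(a)|\<close> and \<open>3 |C(a)| \<le> 32\<close>.\<close>

lemma square_in_center:
  assumes order: "order G = 32" and a: "a \<in> carrier G"
  shows "a \<otimes> a \<in> group_center G"
proof (rule ccontr)
  assume aa: "a \<otimes> a \<notin> group_center G"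
  let ?C = "{g \<in> carrier G. g \<otimes> a = a \<otimes> g}" and ?Z = "group_center G"
  have fin: "finite (carrier G)"
    using order order_gt_0_iff_finite by simp
  have C: "subgroup ?C G" using a by (rule centralizer_subgroup)
  \<comment> \<open>If x and x^2 avoid \<open>H\<close>, then 1, x and x^2 represent three different
    cosets of \<open>H\<close>.\<close>
  have three: "3 * card H \<le> card K"
    if H: "subgroup H G" and K: "subgroup K G" and "H \<subseteq> K" "x \<in> K" "x \<notin> H" "x \<otimes> x \<notin> H" for H K x
  proof -
    have x: "x \<in> carrier G" using subgroup.mem_carrier[OF K] that by simp
    have inv: "y \<in> carrier G \<Longrightarrow> inv y \<in> H \<Longrightarrow> y \<in> H" for y
      using subgroup.m_inv_closed[OF H, of "inv y"] by simp
    have ne: "x \<noteq> \<one>" "x \<otimes> x \<noteq> \<one>" "x \<otimes> x \<noteq> x"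
      using that x subgroup.one_closed[OF H] by auto
    have "card {\<one>, x, x \<otimes> x} * card H \<le> card K"
    proof (rule card_mult_le[OF H K \<open>H \<subseteq> K\<close>])
      show "{\<one>, x, x \<otimes> x} \<subseteq> K"
        using that subgroup.one_closed[OF K] subgroup.m_closed[OF K] by auto
      show "finite K"
        using fin subgroup.subset[OF K] finite_subset by blast
      have "x \<otimes> inv (x \<otimes> x) = inv x" "x \<otimes> x \<otimes> inv x = x"
        using x by (simp_all add: inv_mult_group m_assoc) (simp add: m_assoc[symmetric])
      then show "y = z" if "y \<in> {\<one>, x, x \<otimes> x}" "z \<in> {\<one>, x, x \<otimes> x}" "y \<otimes> inv z \<in> H" for y z
        using that x \<open>x \<notin> H\<close> \<open>x \<otimes> x \<notin> H\<close> inv[of x] inv[of "x \<otimes> x"] by auto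
    qed
    then show ?thesis using ne by simp
  qed
  obtain b where b: "b \<in> carrier G" "commutator G (a \<otimes> a) b \<noteq> \<one>"
    using aa a by (elim not_centerE[rotated]) auto
  then have comm: "commutator G a b \<otimes> commutator G a b \<noteq> \<one>"
    using a by (simp add: commutator_mult_left)
  \<comment> \<open>By bilinearity [a, b^2] = [a, b]^2 = [a^2, b], which is nontrivial. So b and b^2
    both avoid the centralizer of \<open>a\<close>.\<close>
  have "commutator G a (b \<otimes> b) \<noteq> \<one>" "commutator G a b \<noteq> \<one>"
    using comm a b by (auto simp: commutator_mult_right)
  then have "b \<notin> ?C" "b \<otimes> b \<notin> ?C"
    using a b by (auto simp: commutator_eq_one_iff)
  then have C_le: "3 * card ?C \<le> 32"
    using three[OF C subgroup_self _ b(1)] order by (auto simp: order_def)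
  have "a \<notin> ?Z"
    using aa subgroup.m_closed[OF center_subgroup] by blast
  then have Z_le: "3 * card ?Z \<le> card ?C"
    using a aa by (intro three[OF center_subgroup C, of a]) (auto simp: group_center_def)
  let ?k = "commutator G a b"
  have k: "?k \<in> ?Z" "?k \<in> carrier G"
    using a b commutator_center by auto
  have Z: "{\<one>, ?k, ?k \<otimes> ?k} \<subseteq> ?Z"
    using k subgroup.one_closed[OF center_subgroup] subgroup.m_closed[OF center_subgroup] by simp
  have "?k \<noteq> \<one>" "?k \<otimes> ?k \<noteq> ?k"
    using comm k by auto
  then have "card {\<one>, ?k, ?k \<otimes> ?k} = 3"
    using comm by simp
  moreover have "card {\<one>, ?k, ?k \<otimes> ?k} \<le> card ?Z"
    using finite_subset[OF subgroup.subset[OF center_subgroup] fin] Z by (rule card_mono)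
  \<comment> \<open>The centre has at least three elements, and 3 does not divide 32, so it has at
    least four. Then the centralizer has at least 12, and 3 times 12 exceeds 32.\<close>
  moreover have "card ?Z \<noteq> 3"
  proof
    assume "card ?Z = 3"
    then have "3 dvd (32 :: nat)"
      using lagrange[OF center_subgroup] order by (metis dvd_triv_right)
    then show False by presburger
  qed
  ultimately show False using C_le Z_le by linarith
qed

end

section \<open>Central involutions and fourth powers\<close>

context class_two_group
begin

text \<open>A maximal one among the subgroups containing the centre but not \<open>g\<close> has index two.\<close>

lemma exists_index_two_subgroup:
  assumes fin: "finite (carrier G)"
    and squares: "\<And>x. x \<in> carrier G \<Longrightarrow> x \<otimes> x \<in> group_center G"
    and g: "g \<in> carrier G" "g \<notin> group_center G"
  obtains M where "subgroup M G" "group_center G \<subseteq> M" "g \<notin> M"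
    "\<And>x y. \<lbrakk>x \<in> carrier G; y \<in> carrier G; x \<notin> M; y \<notin> M\<rbrakk> \<Longrightarrow> x \<otimes> y \<in> M"
proof -
  let ?S = "{M. subgroup M G \<and> group_center G \<subseteq> M \<and> g \<notin> M}"
  have "?S \<subseteq> Pow (carrier G)"
    using subgroup.subset by blast
  then have "finite ?S"
    using fin finite_subset by blast
  moreover have "?S \<noteq> {}"
    using center_subgroup g by blast
  ultimately have "\<exists>M \<in> ?S. \<forall>N \<in> ?S. M \<subseteq> N \<longrightarrow> M = N"
    by (rule finite_has_maximal)
  then obtain M where "M \<in> ?S" and maximal: "\<And>N. N \<in> ?S \<Longrightarrow> M \<subseteq> N \<Longrightarrow> M = N"
    by (elim bexE) simp
  then have M: "subgroup M G" "group_center G \<subseteq> M" "g \<notin> M" by simp_all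
  note M_mult = subgroup.m_closed[OF M(1)]
  have square_M: "x \<otimes> x \<in> M" "inv (x \<otimes> x) \<in> M" if "x \<in> carrier G" for x
    using squares[OF that] M(2) subgroup.m_inv_closed[OF M(1)] by auto
  have M_sym: "y \<otimes> x \<in> M" if "x \<in> carrier G" "y \<in> carrier G" "x \<otimes> y \<in> M" for x y
    using that mult_commutator[of y x] commutator_center[of y x] M(2) M_mult[of "x \<otimes> y"] by auto
  have M_trans: "x \<otimes> z \<in> M"
    if "x \<in> carrier G" "y \<in> carrier G" "z \<in> carrier G" "x \<otimes> y \<in> M" "y \<otimes> z \<in> M" for x y z
  proof -
    have "(x \<otimes> y) \<otimes> (inv (y \<otimes> y) \<otimes> (y \<otimes> z)) = x \<otimes> (y \<otimes> inv y) \<otimes> (inv y \<otimes> y) \<otimes> z"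
      using that(1-3) by (simp only: m_assoc m_closed inv_closed inv_mult_group)
    also have "\<dots> = x \<otimes> z"
      using that(1-3) by simp
    finally show ?thesis
      using that square_M(2) M_mult by metis
  qed
  have key: "x \<otimes> g \<in> M" if x: "x \<in> carrier G" "x \<notin> M" for x
  proof -
    \<comment> \<open>As x^2 lies in \<open>M\<close>, the second alternative says that
      \<open>y\<close> is in the coset of \<open>x\<close>. So \<open>?N\<close> is generated by
      \<open>M\<close> and \<open>x\<close>, is larger than \<open>M\<close>, and by maximality
      contains \<open>g\<close>.\<close>
    let ?N = "{y \<in> carrier G. y \<in> M \<or> x \<otimes> y \<in> M}"
    have "subgroup ?N G"
    proof (rule subgroupI)
      show "?N \<noteq> {}" using x square_M by blast
    next
      fix y assume y: "y \<in> ?N"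
      then have yc: "y \<in> carrier G" by simp
      have "(x \<otimes> y) \<otimes> inv (y \<otimes> y) = x \<otimes> (y \<otimes> inv y) \<otimes> inv y"
        using x yc by (simp only: m_assoc m_closed inv_closed inv_mult_group)
      also have "\<dots> = x \<otimes> inv y"
        using x yc by simp
      finally have "x \<otimes> inv y \<in> M" if "x \<otimes> y \<in> M"
        using M_mult[OF that square_M(2)[OF yc]] by simp
      then show "inv y \<in> ?N"
        using y subgroup.m_inv_closed[OF M(1)] by auto
    next
      fix y z assume y: "y \<in> ?N" and z: "z \<in> ?N"
      then have closed: "y \<in> carrier G" "z \<in> carrier G" by auto
      consider "y \<in> M" "z \<in> M" | "y \<in> M" "x \<otimes> z \<in> M" | "x \<otimes> y \<in> M" "z \<in> M"
        | "x \<otimes> y \<in> M" "x \<otimes> z \<in> M"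
        using y z by blast
      then show "y \<otimes> z \<in> ?N"
      proof cases
        case 1
        then show ?thesis using M_mult closed by simp
      next
        case 2
        then have "(z \<otimes> x) \<otimes> y \<in> M"
          using M_mult M_sym[of x z] x closed by simp
        then have "x \<otimes> (y \<otimes> z) \<in> M"
          using M_sym[of z "x \<otimes> y"] x closed by (simp add: m_assoc)
        then show ?thesis using closed by simp
      next
        case 3
        then have "x \<otimes> (y \<otimes> z) \<in> M"
          using M_mult[of "x \<otimes> y" z] x closed by (simp add: m_assoc)
        then show ?thesis using closed by simp
      next
        case 4
        then have "y \<otimes> z \<in> M"
          using M_trans[of y x z] M_sym[of x y] x closed by simp
        then show ?thesis using closed by simp
      qed
    qed auto
    moreover have "M \<subseteq> ?N" "x \<in> ?N"
      using subgroup.subset[OF M(1)] square_M x by auto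
    ultimately have "g \<in> ?N"
      using maximal[of ?N] M(2) x(2) by blast
    with M(3) show ?thesis by simp
  qed
  show ?thesis
  proof (rule that[OF M])
    fix x y assume "x \<in> carrier G" "y \<in> carrier G" "x \<notin> M" "y \<notin> M"
    \<comment> \<open>By \<open>key\<close> both elements lie in the coset of \<open>g\<close>,
      whose square is in \<open>M\<close>.\<close>
    then show "x \<otimes> y \<in> M"
      using key[of x] key[of y] M_sym[of y g] M_trans[of x g y] g by simp
  qed
qed

text \<open>The homomorphism \<open>f\<close> with kernel \<open>M\<close> and value
  \<open>u\<close> off \<open>M\<close> is central-valued. A subgroup \<open>M\<close> avoiding
  \<open>g\<close> gives \<open>f g\<close> = \<open>u\<close>, so \<open>u\<close> must be a
  commutator with \<open>g\<close>.\<close>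

lemma involution_is_commutator:
  assumes le: "Aut_z G \<subseteq> Aut_c G" and fin: "finite (carrier G)"
    and squares: "\<And>x. x \<in> carrier G \<Longrightarrow> x \<otimes> x \<in> group_center G"
    and u: "u \<in> group_center G" "u \<otimes> u = \<one>"
    and g: "g \<in> carrier G" "g \<notin> group_center G"
  shows "\<exists>h \<in> carrier G. commutator G g h = u"
proof -
  obtain M where M: "subgroup M G" "group_center G \<subseteq> M" "g \<notin> M"
    and index: "\<And>x y. \<lbrakk>x \<in> carrier G; y \<in> carrier G; x \<notin> M; y \<notin> M\<rbrakk> \<Longrightarrow> x \<otimes> y \<in> M"
    using exists_index_two_subgroup[OF fin squares g] by blast
  have uc: "u \<in> carrier G" "u \<in> M"
    using u M center_in_carrier by auto
  have mult_left: "x \<otimes> y \<in> M \<longleftrightarrow> y \<in> M" if "x \<in> M" "y \<in> carrier G" for x y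
  proof
    assume "x \<otimes> y \<in> M"
    then have "inv x \<otimes> (x \<otimes> y) \<in> M"
      using that M(1) by (simp add: subgroup.m_closed subgroup.m_inv_closed)
    then show "y \<in> M"
      using that subgroup.mem_carrier[OF M(1)] by (simp add: m_assoc[symmetric])
  qed (use that subgroup.m_closed[OF M(1)] in simp)
  have mult_right: "y \<otimes> x \<in> M \<longleftrightarrow> y \<in> M" if "x \<in> M" "y \<in> carrier G" for x y
  proof
    assume "y \<otimes> x \<in> M"
    then have "(y \<otimes> x) \<otimes> inv x \<in> M"
      using that M(1) by (simp add: subgroup.m_closed subgroup.m_inv_closed)
    then show "y \<in> M"
      using that subgroup.mem_carrier[OF M(1)] by (simp add: m_assoc)
  qed (use that subgroup.m_closed[OF M(1)] in simp)
  define f where "f x = (if x \<in> M then \<one> else u)" for x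
  have "\<exists>h \<in> carrier G. commutator G g h = f g"
  proof (rule central_hom_is_commutator[OF le fin _ _ _ g(1)])
    show "f x \<in> group_center G" if "x \<in> carrier G" for x
      using u subgroup.one_closed[OF center_subgroup] by (simp add: f_def)
    show "f (x \<otimes> y) = f x \<otimes> f y" if "x \<in> carrier G" "y \<in> carrier G" for x y
      using that uc u(2) index[of x y] mult_left[of x y] mult_right[of y x] by (auto simp: f_def)
    show "x = y" if "x \<in> carrier G" "y \<in> carrier G" "x \<otimes> f x = y \<otimes> f y" for x y
    proof -
      \<comment> \<open>Since \<one> and \<open>u\<close> lie in \<open>M\<close>, multiplying by a
        value of \<open>f\<close> does not change membership in \<open>M\<close>.\<close>
      have "x \<in> M \<longleftrightarrow> y \<in> M"
        using that uc mult_right[of u] by (auto simp: f_def split: if_splits)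
      then show ?thesis
        using that uc by (auto simp: f_def split: if_splits)
    qed
  qed
  then show ?thesis
    using M(3) by (simp add: f_def)
qed

text \<open>Fourth powers form a homomorphism into the centre, so the fifth power map is a central
  automorphism. As a class preserving one it fixes the central element \<open>z\<close>, whence z^4
  = 1.\<close>

lemma center_fourth_power:
  assumes le: "Aut_z G \<subseteq> Aut_c G" and order: "order G = 32"
    and squares: "\<And>x. x \<in> carrier G \<Longrightarrow> x \<otimes> x \<in> group_center G"
    and z: "z \<in> group_center G"
  shows "(z \<otimes> z) \<otimes> (z \<otimes> z) = \<one>"
proof -
  have fin: "finite (carrier G)"
    using order order_gt_0_iff_finite by simp
  define q where "q x = x \<otimes> x" for x
  have q_center: "q x \<in> group_center G" if "x \<in> carrier G" for x
    using squares that by (simp add: q_def)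
  have q_closed: "q x \<in> carrier G" if "x \<in> carrier G" for x
    using that by (simp add: q_def)
  have q_central_mult: "q (x \<otimes> y) = q x \<otimes> q y" if "x \<in> group_center G" "y \<in> carrier G" for x y
  proof -
    have "q (x \<otimes> y) = x \<otimes> (y \<otimes> x) \<otimes> y"
      using that center_in_carrier by (simp add: q_def m_assoc)
    also have "\<dots> = q x \<otimes> q y"
      using that center_in_carrier by (simp add: q_def m_assoc center_commute[OF that, symmetric])
    finally show ?thesis .
  qed
  have "\<exists>h \<in> carrier G. commutator G z h = q (q z)"
  proof (rule central_hom_is_commutator[OF le fin, of "\<lambda>x. q (q x)"])
    show "q (q x) \<in> group_center G" if "x \<in> carrier G" for x
      using that q_center q_closed by simp
    show "q (q (x \<otimes> y)) = q (q x) \<otimes> q (q y)" if xy: "x \<in> carrier G" "y \<in> carrier G" for x y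
    proof -
      let ?k = "commutator G y x"
      have k: "?k \<in> group_center G" "?k \<in> carrier G"
        using xy commutator_center by auto
      have "q (x \<otimes> y) = x \<otimes> (y \<otimes> x) \<otimes> y"
        using xy by (simp add: q_def m_assoc)
      also have "\<dots> = x \<otimes> x \<otimes> y \<otimes> (?k \<otimes> y)"
        using xy k mult_commutator[of y x] by (simp add: m_assoc)
      also have "\<dots> = q x \<otimes> (q y \<otimes> ?k)"
        using xy k by (simp add: q_def m_assoc center_commute[OF k(1) xy(2)])
      finally have q_mult: "q (x \<otimes> y) = q x \<otimes> (q y \<otimes> ?k)" .
      \<comment> \<open>The correction factor in the square of a product itself squares to [y^2, x],
        which is trivial because y^2 is central.\<close>
      have "q ?k = commutator G (y \<otimes> y) x"
        using xy by (simp add: q_def commutator_mult_left)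
      then have "q ?k = \<one>"
        using xy squares by (simp add: commutator_center_left)
      then have "q (q x \<otimes> (q y \<otimes> ?k)) = q (q x) \<otimes> q (q y)"
        using xy k q_center q_closed by (simp add: q_central_mult)
      then show ?thesis by (simp add: q_mult)
    qed
    show "x = y" if xy: "x \<in> carrier G" "y \<in> carrier G" "x \<otimes> q (q x) = y \<otimes> q (q y)" for x y
    proof -
      \<comment> \<open>\<open>x \<mapsto> x\<^sup>5\<close> is inverted by \<open>x \<mapsto> x\<^sup>1\<^sup>3\<close>, as \<open>5 \<sqdot> 13 = 2 \<sqdot> 32 + 1\<close>.\<close>
      have fifth: "x \<otimes> q (q x) = x [^] (5 :: nat)" if "x \<in> carrier G" for x
        using that by (simp add: q_def numeral_eq_Suc m_assoc)
      have inverse: "(x [^] (5 :: nat)) [^] (13 :: nat) = x" if x: "x \<in> carrier G" for x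
      proof -
        have "(x [^] (5 :: nat)) [^] (13 :: nat) = x [^] (32 * 2 + 1 :: nat)"
          using x by (simp add: nat_pow_pow)
        also have "\<dots> = (x [^] (32 :: nat)) [^] (2 :: nat) \<otimes> x [^] (1 :: nat)"
          using x by (simp only: nat_pow_mult[symmetric] nat_pow_pow)
        also have "x [^] (32 :: nat) = \<one>"
          using pow_order_eq_1[OF x] order by simp
        finally show ?thesis using x by simp
      qed
      show ?thesis
        using xy fifth inverse by metis
    qed
  qed (use z center_in_carrier in blast)
  then show ?thesis
    using z by (auto simp: q_def commutator_center_left)
qed

text \<open>Two such involutions would give every noncentral g four commutator values, so its
  centralizer would have at most 8 elements. As the centre has at least four, that centralizer would
  consist only of the centre and its coset of g, which is too small for all g at once.\<close>

lemma unique_central_involution: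
  assumes le: "Aut_z G \<subseteq> Aut_c G" and order: "order G = 32"
    and squares: "\<And>x. x \<in> carrier G \<Longrightarrow> x \<otimes> x \<in> group_center G"
    and nonabelian: "group_center G \<noteq> carrier G"
    and u: "u \<in> group_center G" "u \<otimes> u = \<one>" "u \<noteq> \<one>"
    and v: "v \<in> group_center G" "v \<otimes> v = \<one>" "v \<noteq> \<one>"
  shows "u = v"
proof (rule ccontr)
  assume "u \<noteq> v"
  let ?Z = "group_center G"
  have fin: "finite (carrier G)"
    using order order_gt_0_iff_finite by simp
  have finZ: "finite ?Z"
    using subgroup.subset[OF center_subgroup] fin by (rule finite_subset)
  have closed [simp]: "u \<in> carrier G" "v \<in> carrier G"
    using u v center_in_carrier by auto
  have uv: "u \<otimes> v \<in> ?Z" "u \<otimes> v = v \<otimes> u"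
    using u v subgroup.m_closed[OF center_subgroup] center_commute by auto
  have cancel: "u \<otimes> (u \<otimes> v) = v" "v \<otimes> (u \<otimes> v) = u" "(u \<otimes> v) \<otimes> v = u"
  proof -
    show "u \<otimes> (u \<otimes> v) = v" "(u \<otimes> v) \<otimes> v = u"
      using u v by (simp_all add: m_assoc[of u v v] m_assoc[of u u v, symmetric])
    show "v \<otimes> (u \<otimes> v) = u"
      unfolding uv(2) using v by (simp add: m_assoc[symmetric])
  qed
  have distinct: "u \<otimes> v \<noteq> \<one>" "u \<otimes> v \<noteq> u" "u \<otimes> v \<noteq> v"
  proof -
    show "u \<otimes> v \<noteq> \<one>"
      using cancel(1) \<open>u \<noteq> v\<close> by auto
    show "u \<otimes> v \<noteq> u" "u \<otimes> v \<noteq> v"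
      using u(3) v(3) by auto
  qed
  have four: "card {\<one>, u, v, u \<otimes> v} = 4"
    using distinct u v \<open>u \<noteq> v\<close> by simp
  have four_subset: "{\<one>, u, v, u \<otimes> v} \<subseteq> ?Z"
    using u v uv subgroup.one_closed[OF center_subgroup] by simp
  then have Z_ge: "4 \<le> card ?Z"
    using card_mono[OF finZ] four by metis
  have is_commutator: "\<exists>h \<in> carrier G. commutator G g h = w"
    if "w \<in> ?Z" "w \<otimes> w = \<one>" "g \<in> carrier G" "g \<notin> ?Z" for g w
    using squares that by (intro involution_is_commutator[OF le fin])
  have C_le: "card {x \<in> carrier G. x \<otimes> g = g \<otimes> x} \<le> 8"
    if g: "g \<in> carrier G" "g \<notin> ?Z" for g
  proof -
    let ?C = "{x \<in> carrier G. x \<otimes> g = g \<otimes> x}"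
    obtain h where h: "h \<in> carrier G" "commutator G g h = u"
      using is_commutator[OF u(1,2) g] by blast
    obtain k where k: "k \<in> carrier G" "commutator G g k = v"
      using is_commutator[OF v(1,2) g] by blast
    \<comment> \<open>The commutators of \<open>g\<close> with these elements are the four values 1,
      u, v and uv, so they represent four different cosets of the centralizer.\<close>
    let ?T = "{\<one>, h, k, h \<otimes> k}"
    have vals: "commutator G g \<one> = \<one>" "commutator G g (h \<otimes> k) = u \<otimes> v"
      using g h k by (simp_all add: commutator_mult_right commutator_eq_one_iff)
    then have image: "(commutator G g) ` ?T = {\<one>, u, v, u \<otimes> v}"
      using h k by simp
    have inj: "inj_on (commutator G g) ?T" "card ?T = 4"
    proof -
      have "card ?T \<le> 4" by (simp add: card_insert_if)
      moreover have "4 \<le> card ?T"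
        using card_image_le[of ?T "commutator G g"] image four by simp
      ultimately show "card ?T = 4" by simp
      then show "inj_on (commutator G g) ?T"
        using image four by (intro eq_card_imp_inj_on) simp_all
    qed
    have "card ?T * card ?C \<le> card (carrier G)"
    proof (rule card_mult_le[OF centralizer_subgroup[OF g(1)] subgroup_self _ _ fin])
      show "x = y" if xy: "x \<in> ?T" "y \<in> ?T" "x \<otimes> inv y \<in> ?C" for x y
      proof -
        have c: "x \<in> carrier G" "y \<in> carrier G"
          using xy h k by auto
        have "commutator G g x = commutator G g (x \<otimes> inv y \<otimes> y)"
          using c by (simp add: m_assoc)
        also have "\<dots> = commutator G g (x \<otimes> inv y) \<otimes> commutator G g y"
          using c g by (intro commutator_mult_right) auto
        also have "commutator G g (x \<otimes> inv y) = \<one>"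
          using c g xy(3) by (simp add: commutator_eq_one_iff)
        finally have "commutator G g x = commutator G g y"
          using c g by simp
        then show ?thesis
          by (rule inj_onD[OF inj(1) _ xy(1,2)])
      qed
    qed (use h k in auto)
    then show ?thesis
      using inj order by (simp add: order_def)
  qed
  have commuting: "commutator G k w = \<one> \<or> commutator G k w = commutator G k g"
    if c: "g \<in> carrier G" "w \<in> carrier G" "k \<in> carrier G"
      and nontrivial: "commutator G g l \<noteq> \<one>" "l \<in> carrier G" and gw: "commutator G g w = \<one>" for g w k l
  proof -
    let ?C = "{x \<in> carrier G. x \<otimes> g = g \<otimes> x}"
    have g: "g \<notin> ?Z"
      using nontrivial commutator_center_left by blast
    have inv_Z: "x \<in> ?Z" if "x \<in> carrier G" "inv x \<in> ?Z" for x
      using subgroup.m_inv_closed[OF center_subgroup that(2)] that(1) by simp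
    \<comment> \<open>Otherwise 1, g and w represent three cosets of the centre in the centralizer
      of \<open>g\<close>, giving at least 12 elements where at most 8 are possible.\<close>
    have "w \<in> ?Z \<or> w \<otimes> inv g \<in> ?Z"
    proof (rule ccontr)
      assume w: "\<not> ?thesis"
      have gw': "g \<otimes> inv w \<notin> ?Z"
        using w c inv_Z[of "w \<otimes> inv g"] by (auto simp: inv_mult_group)
      have ne: "\<one> \<noteq> g" "\<one> \<noteq> w" "g \<noteq> w"
        using g w c subgroup.one_closed[OF center_subgroup] by auto
      have "card {\<one>, g, w} * card ?Z \<le> card ?C"
      proof (rule card_mult_le[OF center_subgroup centralizer_subgroup[OF c(1)]])
        show "?Z \<subseteq> ?C"
          using center_in_carrier center_commute[OF _ c(1)] by blast
        show "{\<one>, g, w} \<subseteq> ?C"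
          using c gw by (simp add: commutator_eq_one_iff)
        show "finite ?C" using fin by simp
        show "x = y" if "x \<in> {\<one>, g, w}" "y \<in> {\<one>, g, w}" "x \<otimes> inv y \<in> ?Z" for x y
          using that c g w gw' inv_Z[of g] inv_Z[of w] by auto
      qed
      then show False
        using ne C_le[OF c(1) g] Z_ge by simp
    qed
    then show ?thesis
    proof
      assume "w \<otimes> inv g \<in> ?Z"
      then have "commutator G k (w \<otimes> inv g) = \<one>"
        using c by (simp add: commutator_center_right)
      moreover have "commutator G k (w \<otimes> inv g \<otimes> g) = commutator G k (w \<otimes> inv g) \<otimes> commutator G k g"
        using c by (intro commutator_mult_right) auto
      ultimately show ?thesis
        using c by (simp add: m_assoc)
    qed (use c commutator_center_right in blast)
  qed
  obtain a where a: "a \<in> carrier G" "a \<notin> ?Z"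
    using nonabelian center_in_carrier by blast
  obtain b where b: "b \<in> carrier G" "commutator G a b = u"
    using is_commutator[OF u(1,2) a] by blast
  obtain c where c: "c \<in> carrier G" "commutator G a c = v"
    using is_commutator[OF v(1,2) a] by blast
  have ba: "commutator G b a = u"
    using commutator_swap[OF a(1) b(1)] a b u inv_equality[of u u]
      inv_equality[of "commutator G b a" u] by simp
  have ca: "commutator G c a = v"
    using commutator_swap[OF a(1) c(1)] a c v inv_equality[of v v]
      inv_equality[of "commutator G c a" v] by simp
  have Z: "?Z = {\<one>, u, v, u \<otimes> v}"
  proof -
    let ?C = "{x \<in> carrier G. x \<otimes> a = a \<otimes> x}"
    \<comment> \<open>Twice the order of the centre is at most 8, so the four known central elements
      exhaust it.\<close>
    have "card {\<one>, a} * card ?Z \<le> card ?C"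
    proof (rule card_mult_le[OF center_subgroup centralizer_subgroup[OF a(1)]])
      show "?Z \<subseteq> ?C"
        using center_in_carrier center_commute[OF _ a(1)] by blast
      show "x = y" if "x \<in> {\<one>, a}" "y \<in> {\<one>, a}" "x \<otimes> inv y \<in> ?Z" for x y
        using that a subgroup.m_inv_closed[OF center_subgroup, of "inv a"] by auto
    qed (use a fin in auto)
    moreover have "\<one> \<noteq> a"
      using a subgroup.one_closed[OF center_subgroup] by auto
    ultimately have "card ?Z \<le> card {\<one>, u, v, u \<otimes> v}"
      using C_le[OF a] four by simp
    then show ?thesis
      using card_seteq[OF finZ four_subset] by simp
  qed
  have "commutator G b c \<in> {\<one>, u, v, u \<otimes> v}"
    using commutator_center[OF b(1) c(1)] Z by simp
  then consider "commutator G b c = \<one>" | "commutator G b c = u" | "commutator G b c = v"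
    | "commutator G b c = u \<otimes> v"
    by blast
  \<comment> \<open>In each case a commuting pair is found whose commutators with \<open>a\<close>
    are u and v, against \<open>commuting\<close>: in order b and c, b and ac, c and ab, ab and
    ac.\<close>
  then show False
  proof cases
    case 1
    then show False
      using commuting[of b c a a] a b c ba u(3) v(3) \<open>u \<noteq> v\<close> by simp
  next
    case 2
    then have "commutator G b (a \<otimes> c) = \<one>" "commutator G a (a \<otimes> c) = v"
      using a b c ba u by (simp_all add: commutator_mult_right commutator_self)
    then show False
      using commuting[of b "a \<otimes> c" a a] a b c ba u(3) v(3) \<open>u \<noteq> v\<close> by simp
  next
    case 3
    then have "commutator G c b = v"
      using commutator_swap[OF b(1) c(1)] b c v inv_equality[of v v]
        inv_equality[of "commutator G c b" v] by simp
    then have "commutator G c (a \<otimes> b) = \<one>" "commutator G a (a \<otimes> b) = u"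
      using a b c ca v by (simp_all add: commutator_mult_right commutator_self)
    then show False
      using commuting[of c "a \<otimes> b" a a] a b c ca u(3) v(3) \<open>u \<noteq> v\<close> by simp
  next
    case 4
    then have "commutator G (a \<otimes> b) a = u" "commutator G (a \<otimes> b) c = u"
      using a b c ba cancel by (simp_all add: commutator_mult_left commutator_self)
    then have "commutator G (a \<otimes> b) (a \<otimes> c) = \<one>" "commutator G (a \<otimes> b) a \<noteq> \<one>"
      "commutator G a (a \<otimes> c) = v" "commutator G a (a \<otimes> b) = u"
      using a b c u by (simp_all add: commutator_mult_right commutator_self)
    then show False
      using commuting[of "a \<otimes> b" "a \<otimes> c" a a] a b c u(3) v(3) \<open>u \<noteq> v\<close> by simp
  qed
qed

end

section \<open>From central automorphisms preserving classes to isoclinism with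
  \<open>G43\<close>\<close>

lemma (in class_two_group) isoclinic_G43:
  assumes le: "Aut_z G \<subseteq> Aut_c G" and order: "order G = 32"
    and nonabelian: "group_center G \<noteq> carrier G"
  shows "isoclinic G G43"
proof -
  let ?Z = "group_center G"
  note squares = square_in_center[OF order]
  obtain a where a: "a \<in> carrier G" "a \<notin> ?Z"
    using nonabelian center_in_carrier by blast
  then obtain b where b: "b \<in> carrier G" "commutator G a b \<noteq> \<one>"
    by (rule not_centerE)
  define t where "t = commutator G a b"
  \<comment> \<open>By bilinearity this is [g^2, h], and squares are central. Hence all commutators
    lie among \<one> and the unique central involution \<open>t\<close>.\<close>
  have commutator_square: "commutator G g h \<otimes> commutator G g h = \<one>"
    if "g \<in> carrier G" "h \<in> carrier G" for g h
    using that commutator_mult_left[of g g h] squares commutator_center_left by simp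
  have t: "t \<in> ?Z" "t \<otimes> t = \<one>" "t \<noteq> \<one>"
    using a b commutator_center commutator_square by (simp_all add: t_def)
  have involution: "z = \<one> \<or> z = t" if "z \<in> ?Z" "z \<otimes> z = \<one>" for z
    using unique_central_involution[OF le order _ nonabelian that(1,2) _ t] squares by blast
  interpret two_commutator_group G t
  proof
    fix g h assume gh: "g \<in> carrier G" "h \<in> carrier G"
    then have "commutator G g h = \<one> \<or> commutator G g h = t"
      using involution commutator_center commutator_square by simp
    then show "g \<otimes> h = h \<otimes> g \<or> g \<otimes> h = h \<otimes> g \<otimes> t"
      using gh mult_commutator[of g h] by auto
  qed (use t in auto)
  have fourth: "z \<otimes> z = \<one> \<or> z \<otimes> z = t" if "z \<in> ?Z" for z
    using involution[of "z \<otimes> z"] squares center_in_carrier that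
      center_fourth_power[OF le order _ that] by blast
  have "\<exists>s \<in> carrier G. ?Z \<subseteq> {\<one>, t, inv s, t \<otimes> inv s}"
  proof (cases "\<exists>s \<in> ?Z. s \<otimes> s = t")
    case True
    then obtain s where s: "s \<in> ?Z" "s \<otimes> s = t" by blast
    have sc: "s \<in> carrier G" using s center_in_carrier by simp
    have "z \<in> {\<one>, t, inv s, t \<otimes> inv s}" if z: "z \<in> ?Z" for z
    proof (cases "z \<otimes> z = \<one>")
      case False
      have zc: "z \<in> carrier G" using z center_in_carrier by simp
      \<comment> \<open>If z^2 and s^2 both equal \<open>t\<close>, then zs is a central element of
        square 1, hence \<one> or \<open>t\<close>. This leaves at most four central
        elements.\<close>
      have "z \<otimes> s \<otimes> (z \<otimes> s) = z \<otimes> (s \<otimes> z) \<otimes> s"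
        using zc sc by (simp add: m_assoc)
      also have "\<dots> = (z \<otimes> z) \<otimes> (s \<otimes> s)"
        using zc sc by (simp add: center_commute[OF s(1) zc] m_assoc)
      also have "\<dots> = \<one>"
        using False fourth[OF z] s t by simp
      finally have "z \<otimes> s = \<one> \<or> z \<otimes> s = t"
        using z s subgroup.m_closed[OF center_subgroup] by (intro involution) auto
      moreover have "z = z \<otimes> s \<otimes> inv s"
        using zc sc by (simp add: m_assoc)
      ultimately have "z = inv s \<or> z = t \<otimes> inv s"
        using sc by auto
      then show ?thesis by blast
    qed (use involution z in blast)
    with sc show ?thesis by blast
  next
    case False
    then have "?Z \<subseteq> {\<one>, t}"
      using fourth involution by blast
    then show ?thesis by blast
  qed
  then obtain s where "?Z \<subseteq> {\<one>, t, inv s, t \<otimes> inv s}" by blast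
  then have "card ?Z \<le> card {\<one>, t, inv s, t \<otimes> inv s}"
    by (intro card_mono) auto
  also have "\<dots> \<le> 4"
    by (simp add: card_insert_if)
  finally obtain a b c d where "symplectic_group G t a b c d"
    using exists_symplectic_basis[OF order] by blast
  moreover obtain t' a' b' c' d' where "symplectic_group G43 t' a' b' c' d'"
    using G43_symplectic by blast
  ultimately show ?thesis
    by (rule symplectic_groups_isoclinic)
qed

section \<open>Class two with centre of order two\<close>

text \<open>Class preserving maps displace by commutators, which are central. Conversely a central
  automorphism can only multiply x by the involution z, and for noncentral x this is conjugation,
  because some commutator [x, g] is nontrivial and so equals z.\<close>

lemma (in class_two_group) Aut_c_eq_Aut_z:
  assumes card: "card (group_center G) = 2"
  shows "Aut_c G = Aut_z G"
proof
  show "Aut_c G \<subseteq> Aut_z G"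
  proof
    fix \<alpha> assume \<alpha>: "\<alpha> \<in> Aut_c G"
    have "inv x \<otimes> \<alpha> x \<in> group_center G" if x: "x \<in> carrier G" for x
    proof -
      obtain g where "g \<in> carrier G" "\<alpha> x = inv g \<otimes> x \<otimes> g"
        using \<alpha> x by (auto simp: Aut_c_def)
      then have "inv x \<otimes> \<alpha> x = commutator G x g"
        using x by (simp add: commutator_def m_assoc)
      then show ?thesis
        using x \<open>g \<in> carrier G\<close> commutator_center by simp
    qed
    then show "\<alpha> \<in> Aut_z G"
      using \<alpha> by (simp add: Aut_c_def Aut_z_def)
  qed
next
  have one: "\<one> \<in> group_center G"
    using subgroup.one_closed[OF center_subgroup] .
  then have "card (group_center G - {\<one>}) = 1"
    using card by simp
  then obtain z where "group_center G - {\<one>} = {z}"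
    by (rule card_1_singletonE)
  with one have Z: "group_center G = {\<one>, z}" "z \<noteq> \<one>"
    by blast+
  have z: "z \<in> carrier G"
    using Z center_in_carrier by blast
  have "z \<otimes> z \<in> {\<one>, z}"
    using Z subgroup.m_closed[OF center_subgroup, of z z] by simp
  then have zz: "z \<otimes> z = \<one>"
    using z Z(2) by auto
  show "Aut_z G \<subseteq> Aut_c G"
  proof
    fix \<phi> assume \<phi>: "\<phi> \<in> Aut_z G"
    have hom: "\<phi> \<in> hom G G" and inj: "inj_on \<phi> (carrier G)"
      using \<phi> by (auto simp: Aut_z_def auto_def Bij_def bij_betw_def)
    have one: "\<phi> \<one> = \<one>"
      using hom_one[OF hom is_group is_group] .
    have closed: "\<phi> x \<in> carrier G" if "x \<in> carrier G" for x
      using hom that by (auto simp: hom_def)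
    have "\<exists>g \<in> carrier G. \<phi> x = inv g \<otimes> x \<otimes> g" if x: "x \<in> carrier G" for x
    proof -
      have "inv x \<otimes> \<phi> x \<in> group_center G"
        using \<phi> x by (simp add: Aut_z_def)
      moreover have "\<phi> x = x \<otimes> (inv x \<otimes> \<phi> x)"
        using x closed by (simp add: m_assoc[symmetric])
      ultimately consider "\<phi> x = x" | "\<phi> x = x \<otimes> z"
        using Z x by auto
      then show ?thesis
      proof cases
        case 1
        then show ?thesis using x by (intro bexI[of _ "\<one>"]) auto
      next
        case 2
        \<comment> \<open>A central element is not moved: \<one> is fixed, and \<open>z\<close>
          cannot go to \<open>z \<otimes> z\<close> = \<one> by injectivity.\<close>
        have "x \<notin> group_center G"
        proof
          assume "x \<in> group_center G"
          then have "x = \<one> \<or> x = z" using Z by simp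
          then show False
            using 2 one zz z Z(2) inj_onD[OF inj, of z "\<one>"] by auto
        qed
        then obtain g where g: "g \<in> carrier G" "commutator G x g \<noteq> \<one>"
          using not_centerE x by blast
        then have "commutator G x g = z"
          using commutator_center[OF x g(1)] Z by simp
        then show ?thesis
          using 2 g(1) conj_eq_mult_commutator[OF x g(1)] by (intro bexI[OF _ g(1)]) simp
      qed
    qed
    then show "\<phi> \<in> Aut_c G"
      using \<phi> by (simp add: Aut_c_def Aut_z_def)
  qed
qed

theorem theorem5p4:
  fixes G :: "('a, 'b) monoid_scheme"
  assumes "group G" and "\<not> comm_group G" and "order G = 2 ^ 5"
  shows "Aut_c G = Aut_z G \<longleftrightarrow> G \<in> Phi5"
proof
  interpret group G by fact
  have order: "order G = 32" using assms(3) by simp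
  have nonabelian: "group_center G \<noteq> carrier G"
    using assms(2) group_comm_groupI by (auto simp: group_center_def)
  show "G \<in> Phi5" if eq: "Aut_c G = Aut_z G"
  proof -
    interpret class_two_group G
      by unfold_locales (rule commutator_center_if_Aut_c_le_Aut_z, use eq in auto)
    show ?thesis
      using isoclinic_G43 eq order nonabelian assms(1) by (simp add: Phi5_def)
  qed
  show "Aut_c G = Aut_z G" if "G \<in> Phi5"
  proof -
    have iso: "isoclinic G G43" using that by (simp add: Phi5_def)
    obtain t a b c d where "symplectic_group G43 t a b c d"
      using G43_symplectic by blast
    then interpret G43: symplectic_group G43 t a b c d .
    have fin: "finite (carrier G)"
      using order order_gt_0_iff_finite by simp
    interpret class_two_group G
      by unfold_locales (rule G43.isoclinic_center(2)[OF assms(1) fin iso])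
    \<comment> \<open>From 32 = 16 |Z(G)| the centre has order two.\<close>
    show ?thesis
      using G43.isoclinic_center(1)[OF assms(1) fin iso] order by (intro Aut_c_eq_Aut_z) simp
  qed
qed

end
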